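(* There exist a $C^*$-algebra $\mathcal{B}$, a (right) Hilbert $\mathcal{B}$-module $E$, a bounded (right) $\mathcal{B}$-linear map $\Phi\colon E\to\mathcal{B}$, and a closed $\mathcal{B}$-submodule $F\subset E$ such that $$E\neq\ker\Phi\supset F\qquad\text{and}\qquad F^{\perp}=\{0\}.$$ In particular, $(\ker\Phi)^{\perp\perp}\supset F^{\perp\perp}=E\neq\ker\Phi$.
   Context: A Hilbert $\mathcal{B}$-module is a right $\mathcal{B}$-module with a $\mathcal{B}$-valued inner product $\langle\cdot,\cdot\rangle$ (conjugate linear in the first argument, right $\mathcal{B}$-linear in the second) that is complete in the norm $\|x\|=\|\langle x,x\rangle\|^{1/2}$. For a subset $S\subset E$ the orthogonal complement is $S^\perp:=\{x\in E:\langle s,x\rangle=0\text{ for all }s\in S\}$, and $S^{\perp\perp}:=(S^\perp)^\perp$. The map $\Phi$ is not required to be adjointable; $\ker\Phi=\{x\in E:\Phi(x)=0\}$. The symbol $\supset$ allows equality. *)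

theory Defs
  imports "HOL-Analysis.Analysis" "HOL-Algebra.Algebra" "HOL-Algebra.Algebraic_Closure_Type"
begin

abbreviation complex_ring :: "complex ring"
  where "complex_ring \<equiv> ring_of_type_algebra"

(* The library locale Metric_space asks a distance to be nonnegative and symmetric on the
   whole type, hence the value 0 off the carrier; only the values on the carrier matter. *)
definition norm_dist :: "('a, 'm) ring_scheme \<Rightarrow> ('a \<Rightarrow> real) \<Rightarrow> 'a \<Rightarrow> 'a \<Rightarrow> real"
  where "norm_dist M n x y =
    (if x \<in> carrier M \<and> y \<in> carrier M then n (x \<ominus>\<^bsub>M\<^esub> y) else 0)"

(* C*-algebras need not be unital, so the field "one" inherited from the record of rings
   carries no meaning in a C*-algebra. *)
record 'b cstar_structure = "(complex, 'b) module" +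
  star :: "'b \<Rightarrow> 'b"
  anorm :: "'b \<Rightarrow> real"

locale cstar_algebra = Module.module complex_ring B
  for B :: "('b, 'm) cstar_structure_scheme" (structure) +
  assumes mult_closed: "\<lbrakk>a \<in> carrier B; b \<in> carrier B\<rbrakk> \<Longrightarrow> a \<otimes> b \<in> carrier B"
    and mult_assoc: "\<lbrakk>a \<in> carrier B; b \<in> carrier B; c \<in> carrier B\<rbrakk>
      \<Longrightarrow> (a \<otimes> b) \<otimes> c = a \<otimes> (b \<otimes> c)"
    and mult_distr_left: "\<lbrakk>a \<in> carrier B; b \<in> carrier B; c \<in> carrier B\<rbrakk>
      \<Longrightarrow> (a \<oplus> b) \<otimes> c = a \<otimes> c \<oplus> b \<otimes> c"
    and mult_distr_right: "\<lbrakk>a \<in> carrier B; b \<in> carrier B; c \<in> carrier B\<rbrakk>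
      \<Longrightarrow> a \<otimes> (b \<oplus> c) = a \<otimes> b \<oplus> a \<otimes> c"
    and smult_mult_left: "\<lbrakk>a \<in> carrier B; b \<in> carrier B\<rbrakk> \<Longrightarrow> (z \<odot> a) \<otimes> b = z \<odot> (a \<otimes> b)"
    and smult_mult_right: "\<lbrakk>a \<in> carrier B; b \<in> carrier B\<rbrakk> \<Longrightarrow> a \<otimes> (z \<odot> b) = z \<odot> (a \<otimes> b)"
    and star_closed: "a \<in> carrier B \<Longrightarrow> star B a \<in> carrier B"
    and star_add: "\<lbrakk>a \<in> carrier B; b \<in> carrier B\<rbrakk> \<Longrightarrow> star B (a \<oplus> b) = star B a \<oplus> star B b"
    and star_smult: "a \<in> carrier B \<Longrightarrow> star B (z \<odot> a) = cnj z \<odot> star B a"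
    and star_mult: "\<lbrakk>a \<in> carrier B; b \<in> carrier B\<rbrakk> \<Longrightarrow> star B (a \<otimes> b) = star B b \<otimes> star B a"
    and star_star: "a \<in> carrier B \<Longrightarrow> star B (star B a) = a"
    and anorm_nonneg: "a \<in> carrier B \<Longrightarrow> 0 \<le> anorm B a"
    and anorm_eq_0: "a \<in> carrier B \<Longrightarrow> anorm B a = 0 \<longleftrightarrow> a = \<zero>"
    and anorm_triangle: "\<lbrakk>a \<in> carrier B; b \<in> carrier B\<rbrakk> \<Longrightarrow> anorm B (a \<oplus> b) \<le> anorm B a + anorm B b"
    and anorm_smult: "a \<in> carrier B \<Longrightarrow> anorm B (z \<odot> a) = cmod z * anorm B a"
    and anorm_mult: "\<lbrakk>a \<in> carrier B; b \<in> carrier B\<rbrakk> \<Longrightarrow> anorm B (a \<otimes> b) \<le> anorm B a * anorm B b"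
    and anorm_star: "a \<in> carrier B \<Longrightarrow> anorm B (star B a \<otimes> a) = (anorm B a)\<^sup>2"
    and complete: "Metric_space.mcomplete (carrier B) (norm_dist B (anorm B))"

definition cstar_positive :: "('b, 'm) cstar_structure_scheme \<Rightarrow> 'b \<Rightarrow> bool"
  where "cstar_positive B a \<longleftrightarrow> (\<exists>b \<in> carrier B. a = star B b \<otimes>\<^bsub>B\<^esub> b)"

(* ract is the right action of the C*-algebra.  The ring multiplication and unit inherited
   from the record of modules carry no meaning (as for modules in HOL-Algebra). *)
record ('b, 'e) hilbert_structure = "(complex, 'e) module" +
  ract :: "'e \<Rightarrow> 'b \<Rightarrow> 'e"
  ip :: "'e \<Rightarrow> 'e \<Rightarrow> 'b"

definition hnorm ::
  "('b, 'm) cstar_structure_scheme \<Rightarrow> ('b, 'e, 'n) hilbert_structure_scheme \<Rightarrow> 'e \<Rightarrow> real"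
  where "hnorm B E x = sqrt (anorm B (ip E x x))"

definition hdist ::
  "('b, 'm) cstar_structure_scheme \<Rightarrow> ('b, 'e, 'n) hilbert_structure_scheme \<Rightarrow> 'e \<Rightarrow> 'e \<Rightarrow> real"
  where "hdist B E = norm_dist E (hnorm B E)"

(* Conjugate linearity of the inner product in its first argument follows from ip_star. *)
locale hilbert_module = cstar_algebra B + E: Module.module complex_ring E
  for B :: "('b, 'm) cstar_structure_scheme" (structure)
    and E :: "('b, 'e, 'n) hilbert_structure_scheme" +
  assumes ract_closed: "\<lbrakk>x \<in> carrier E; b \<in> carrier B\<rbrakk> \<Longrightarrow> ract E x b \<in> carrier E"
    and ract_add_left: "\<lbrakk>x \<in> carrier E; y \<in> carrier E; b \<in> carrier B\<rbrakk>
      \<Longrightarrow> ract E (x \<oplus>\<^bsub>E\<^esub> y) b = ract E x b \<oplus>\<^bsub>E\<^esub> ract E y b"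
    and ract_add_right: "\<lbrakk>x \<in> carrier E; b \<in> carrier B; c \<in> carrier B\<rbrakk>
      \<Longrightarrow> ract E x (b \<oplus> c) = ract E x b \<oplus>\<^bsub>E\<^esub> ract E x c"
    and ract_mult: "\<lbrakk>x \<in> carrier E; b \<in> carrier B; c \<in> carrier B\<rbrakk>
      \<Longrightarrow> ract E x (b \<otimes> c) = ract E (ract E x b) c"
    and ract_smult_left: "\<lbrakk>x \<in> carrier E; b \<in> carrier B\<rbrakk>
      \<Longrightarrow> ract E (z \<odot>\<^bsub>E\<^esub> x) b = z \<odot>\<^bsub>E\<^esub> ract E x b"
    and ract_smult_right: "\<lbrakk>x \<in> carrier E; b \<in> carrier B\<rbrakk>
      \<Longrightarrow> ract E x (z \<odot> b) = z \<odot>\<^bsub>E\<^esub> ract E x b"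
    and ip_closed: "\<lbrakk>x \<in> carrier E; y \<in> carrier E\<rbrakk> \<Longrightarrow> ip E x y \<in> carrier B"
    and ip_add_right: "\<lbrakk>x \<in> carrier E; y \<in> carrier E; w \<in> carrier E\<rbrakk>
      \<Longrightarrow> ip E x (y \<oplus>\<^bsub>E\<^esub> w) = ip E x y \<oplus> ip E x w"
    and ip_smult_right: "\<lbrakk>x \<in> carrier E; y \<in> carrier E\<rbrakk> \<Longrightarrow> ip E x (z \<odot>\<^bsub>E\<^esub> y) = z \<odot> ip E x y"
    and ip_ract_right: "\<lbrakk>x \<in> carrier E; y \<in> carrier E; b \<in> carrier B\<rbrakk>
      \<Longrightarrow> ip E x (ract E y b) = ip E x y \<otimes> b"
    and ip_star: "\<lbrakk>x \<in> carrier E; y \<in> carrier E\<rbrakk> \<Longrightarrow> star B (ip E x y) = ip E y x"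
    and ip_positive: "x \<in> carrier E \<Longrightarrow> cstar_positive B (ip E x x)"
    and ip_definite: "\<lbrakk>x \<in> carrier E; ip E x x = \<zero>\<rbrakk> \<Longrightarrow> x = \<zero>\<^bsub>E\<^esub>"
    and hilbert_complete: "Metric_space.mcomplete (carrier E) (hdist B E)"

definition orth_compl ::
  "('b, 'm) cstar_structure_scheme \<Rightarrow> ('b, 'e, 'n) hilbert_structure_scheme \<Rightarrow> 'e set \<Rightarrow> 'e set"
  where "orth_compl B E S = {x \<in> carrier E. \<forall>s \<in> S. ip E s x = \<zero>\<^bsub>B\<^esub>}"

definition closed_submodule ::
  "('b, 'm) cstar_structure_scheme \<Rightarrow> ('b, 'e, 'n) hilbert_structure_scheme \<Rightarrow> 'e set \<Rightarrow> bool"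
  where "closed_submodule B E F \<longleftrightarrow>
    submodule F complex_ring E \<and>
    (\<forall>x \<in> F. \<forall>b \<in> carrier B. ract E x b \<in> F) \<and>
    closedin (Metric_space.mtopology (carrier E) (hdist B E)) F"

definition bounded_module_map ::
  "('b, 'm) cstar_structure_scheme \<Rightarrow> ('b, 'e, 'n) hilbert_structure_scheme \<Rightarrow> ('e \<Rightarrow> 'b) \<Rightarrow> bool"
  where "bounded_module_map B E \<Phi> \<longleftrightarrow>
    \<Phi> \<in> carrier E \<rightarrow> carrier B \<and>
    (\<forall>x \<in> carrier E. \<forall>y \<in> carrier E. \<Phi> (x \<oplus>\<^bsub>E\<^esub> y) = \<Phi> x \<oplus>\<^bsub>B\<^esub> \<Phi> y) \<and>
    (\<forall>z. \<forall>x \<in> carrier E. \<Phi> (z \<odot>\<^bsub>E\<^esub> x) = z \<odot>\<^bsub>B\<^esub> \<Phi> x) \<and>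
    (\<forall>x \<in> carrier E. \<forall>b \<in> carrier B. \<Phi> (ract E x b) = \<Phi> x \<otimes>\<^bsub>B\<^esub> b) \<and>
    (\<exists>K. \<forall>x \<in> carrier E. anorm B (\<Phi> x) \<le> K * hnorm B E x)"

end

(* Take B = C_b(R) and let E = l^2(B) consist of the sequences (x_n) in B for which the series of
   |x_n|^2 converges uniformly.  For real functions a_n in B such that the sum of the a_n^2 is
   bounded, but not necessarily continuous, Phi(x) = sum a_n x_n is a bounded module map.  The
   sequences a_m e_n - a_n e_m lie in F = ker Phi, so any y in the complement of F satisfies
   a_m y_n = a_n y_m, whence |y_n|^2 * (sum_m a_m^2) = a_n^2 * <y, y>.  Thus sum_m a_m^2 is continuous
   on the open set where y_n does not vanish.  Choosing the a_n such that this sum is discontinuous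
   on every nonempty open set (it is 2 exactly at the irrational numbers) forces y = 0. *)
theory Submission
  imports Defs
begin

section \<open>Bounded continuous functions and square-summable sequences of them\<close>

text \<open>At a fixed t the functional is pairing with the vector (a_n(t)) of the Hilbert space
  l^2, so by Riesz an element of the complement of the kernel is at each t a multiple of that
  vector. The construction has to let continuity in t exclude every such multiple. If the sum of the
  a_n^2 converged uniformly, (a_n) itself would lie in E and be orthogonal to the kernel. Hence
  coefficients and module elements obey different conditions: \<open>ell2_bounded\<close> asks for
  bounded partial sums, \<open>ell2\<close> for uniformly small tails. By Cauchy-Schwarz one
  uniformly small factor is enough for the paired series to converge uniformly, hence to a
  continuous function. As the limit of an increasing sequence of continuous functions, the sum of
  the a_n^2 has a dense set of continuity points by Baire, so discontinuity at every point is out of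
  reach; the aim is that no nonempty open set consists of continuity points. The sum of (1/2)^k
  times the indicator of "t differs from the k-th rational" achieves this. Ramps of slope n
  approximate these indicators from below, and the a_n are the square roots of the successive
  increments.\<close>

lemma L2_set_mono_set: "finite B \<Longrightarrow> A \<subseteq> B \<Longrightarrow> L2_set f A \<le> L2_set f B"
  by (auto simp: L2_set_def intro!: sum_mono2)

lemma L2_set_norm_add_le:
  "L2_set (\<lambda>i. norm (f i + g i)) A \<le> L2_set (\<lambda>i. norm (f i)) A + L2_set (\<lambda>i. norm (g i)) A"
  by (rule order_trans[OF L2_set_mono L2_set_triangle_ineq]) (auto intro: norm_triangle_ineq)

lemma L2_set_norm_diff_le:
  "L2_set (\<lambda>i. norm (f i)) A \<le> L2_set (\<lambda>i. norm (f i - g i)) A + L2_set (\<lambda>i. norm (g i)) A"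
  using L2_set_norm_add_le[of "\<lambda>i. f i - g i" g A] by simp

section \<open>Pointwise operations on bounded continuous functions\<close>

lemma bcontfun_bounded:
  fixes f :: "'a::topological_space \<Rightarrow> 'b::real_normed_vector"
  assumes "f \<in> bcontfun"
  obtains c where "0 \<le> c" "\<And>t. norm (f t) \<le> c"
proof -
  from assms obtain c where "0 < c" "\<forall>t. norm (f t) \<le> c"
    unfolding bcontfun_def bounded_pos by auto
  then show ?thesis using that[of c] by simp
qed

lemma bcontfunI':
  fixes f :: "'a::topological_space \<Rightarrow> 'b::real_normed_vector"
  assumes "continuous_on UNIV f" "\<And>t. norm (f t) \<le> c"
  shows "f \<in> bcontfun"
  using assms by (auto simp: bcontfun_def bounded_iff)

lemma bcontfun_add:
  fixes f g :: "'a::topological_space \<Rightarrow> 'b::real_normed_vector"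
  assumes "f \<in> bcontfun" "g \<in> bcontfun"
  shows "(\<lambda>t. f t + g t) \<in> bcontfun"
  using assms by (auto simp: bcontfun_def intro: continuous_on_add bounded_plus_comp)

lemma bcontfun_mult:
  fixes f g :: "'a::topological_space \<Rightarrow> 'b::real_normed_algebra"
  assumes "f \<in> bcontfun" "g \<in> bcontfun"
  shows "(\<lambda>t. f t * g t) \<in> bcontfun"
proof -
  obtain c where c: "0 \<le> c" "\<And>t. norm (f t) \<le> c" using assms(1) by (rule bcontfun_bounded) blast
  obtain d where d: "0 \<le> d" "\<And>t. norm (g t) \<le> d" using assms(2) by (rule bcontfun_bounded) blast
  show ?thesis
  proof (rule bcontfunI')
    show "continuous_on UNIV (\<lambda>t. f t * g t)"
      using assms by (auto simp: bcontfun_def intro: continuous_on_mult)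
    show "norm (f t * g t) \<le> c * d" for t
      using c d by (intro order_trans[OF norm_mult_ineq mult_mono]) auto
  qed
qed

lemma bcontfun_cmult:
  fixes f :: "'a::topological_space \<Rightarrow> 'b::real_normed_algebra"
  shows "f \<in> bcontfun \<Longrightarrow> (\<lambda>t. z * f t) \<in> bcontfun"
  by (rule bcontfun_mult[OF const_bcontfun])

lemma bcontfun_cnj:
  fixes f :: "'a::topological_space \<Rightarrow> complex"
  assumes "f \<in> bcontfun" shows "(\<lambda>t. cnj (f t)) \<in> bcontfun"
  using bcontfun_bounded[OF assms] assms
  by (auto simp: bcontfun_def bounded_iff intro: continuous_on_cnj)

lemma bcontfun_uminus:
  fixes f :: "'a::topological_space \<Rightarrow> 'b::real_normed_vector"
  shows "f \<in> bcontfun \<Longrightarrow> (\<lambda>t. - f t) \<in> bcontfun"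
  by (auto simp: bcontfun_def bounded_iff intro: continuous_on_minus)

lemma bcontfun_sum:
  fixes f :: "'i \<Rightarrow> 'a::topological_space \<Rightarrow> 'b::real_normed_vector"
  shows "(\<And>i. i \<in> A \<Longrightarrow> f i \<in> bcontfun) \<Longrightarrow> (\<lambda>t. \<Sum>i\<in>A. f i t) \<in> bcontfun"
  by (induction A rule: infinite_finite_induct) (auto intro: const_bcontfun bcontfun_add)

text \<open>Completeness of the type of bounded continuous functions, transported to plain
  functions. It serves three times: for the algebra, for the coordinates of a Cauchy sequence in
  \<open>ell2\<close>, and for the continuity of a paired series.\<close>

lemma bcontfun_sup_Cauchy_convergent:
  fixes g :: "nat \<Rightarrow> 'a::metric_space \<Rightarrow> 'b::complete_space"
  assumes g: "\<And>k. g k \<in> bcontfun"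
    and cau: "\<And>e. e > 0 \<Longrightarrow> \<exists>N. \<forall>i\<ge>N. \<forall>j\<ge>N. \<forall>t. dist (g i t) (g j t) \<le> e"
  shows "\<exists>h\<in>bcontfun. \<forall>e>0. \<exists>N. \<forall>i\<ge>N. \<forall>t. dist (g i t) (h t) \<le> e"
proof -
  define G where "G k = Bcontfun (g k)" for k
  have G: "apply_bcontfun (G k) = g k" for k
    unfolding G_def using g by (rule Bcontfun_inverse)
  have "Cauchy G"
  proof (rule metric_CauchyI)
    fix e :: real assume "e > 0"
    with cau[of "e/2"] obtain N where N: "\<forall>i\<ge>N. \<forall>j\<ge>N. \<forall>t. dist (g i t) (g j t) \<le> e/2" by auto
    have "dist (G i) (G j) < e" if "i \<ge> N" "j \<ge> N" for i j
    proof -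
      have "dist (G i) (G j) \<le> e/2" using N that by (intro dist_bound) (simp add: G)
      with \<open>e > 0\<close> show ?thesis by simp
    qed
    then show "\<exists>N. \<forall>i\<ge>N. \<forall>j\<ge>N. dist (G i) (G j) < e" by blast
  qed
  then obtain H where H: "G \<longlonglongrightarrow> H" by (auto simp: Cauchy_convergent_iff convergent_def)
  show ?thesis
  proof (intro bexI[OF _ apply_bcontfun[of H]] allI impI)
    fix e :: real assume "e > 0"
    with H obtain N where "\<forall>i\<ge>N. dist (G i) H < e" by (meson metric_LIMSEQ_D)
    then show "\<exists>N. \<forall>i\<ge>N. \<forall>t. dist (g i t) (apply_bcontfun H t) \<le> e"
      by (metis G dist_fun_lt_imp_dist_val_lt less_imp_le)
  qed
qed

section \<open>The supremum norm\<close>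

definition sup_norm :: "('a \<Rightarrow> complex) \<Rightarrow> real"
  where "sup_norm f = (SUP t. cmod (f t))"

text \<open>Boundedness makes the real supremum meaningful. Through this equivalence norm estimates
  become pointwise ones.\<close>

lemma sup_norm_le_iff:
  assumes "f \<in> bcontfun" shows "sup_norm f \<le> c \<longleftrightarrow> (\<forall>t. cmod (f t) \<le> c)"
proof -
  have "bdd_above (range (\<lambda>t. cmod (f t)))"
    using bcontfun_bounded[OF assms] by (metis bdd_above.I2)
  then show ?thesis by (simp add: sup_norm_def cSUP_le_iff)
qed

lemma cmod_le_sup_norm: "f \<in> bcontfun \<Longrightarrow> cmod (f t) \<le> sup_norm f"
  using sup_norm_le_iff by blast

lemma sup_norm_nonneg: "f \<in> bcontfun \<Longrightarrow> 0 \<le> sup_norm f"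
  using cmod_le_sup_norm norm_ge_zero order_trans by blast

text \<open>Uniform convergence of the series of squared moduli, written as a Cauchy condition on
  finite blocks: no infinite sum occurs, and the square root in \<open>L2_set\<close> lets
  Minkowski's inequality apply directly.\<close>

definition ell2 :: "(nat \<Rightarrow> 'a::metric_space \<Rightarrow> complex) set"
  where "ell2 = {x. (\<forall>n. x n \<in> bcontfun) \<and>
    (\<forall>e>0. \<exists>N. \<forall>M t. L2_set (\<lambda>n. cmod (x n t)) {N..<M} \<le> e)}"

text \<open>The condition on the coefficients of a functional. Tails may fail to be uniformly small,
  which is how a functional can avoid being an inner product with an element of
  \<open>ell2\<close>.\<close>

definition ell2_bounded :: "real \<Rightarrow> (nat \<Rightarrow> 'a::metric_space \<Rightarrow> complex) \<Rightarrow> bool"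
  where "ell2_bounded c a \<longleftrightarrow> (\<forall>n. a n \<in> bcontfun) \<and>
    (\<forall>M t. L2_set (\<lambda>n. cmod (a n t)) {..<M} \<le> c)"

text \<open>Bilinear, without conjugation, so that one set of lemmas covers both the functionals
  and, after conjugating the first argument, the inner product.\<close>

definition pairing :: "(nat \<Rightarrow> 'a \<Rightarrow> complex) \<Rightarrow> (nat \<Rightarrow> 'a \<Rightarrow> complex) \<Rightarrow> 'a \<Rightarrow> complex"
  where "pairing a x t = suminf (\<lambda>n. a n t * x n t)"

lemma ell2_bounded_nonneg: "ell2_bounded c a \<Longrightarrow> 0 \<le> c"
  unfolding ell2_bounded_def using L2_set_nonneg order_trans by blast

lemma ell2_bcontfun: "x \<in> ell2 \<Longrightarrow> x n \<in> bcontfun"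
  by (simp add: ell2_def)

lemma ell2_tail:
  assumes "x \<in> ell2" "e > 0"
  obtains N where "\<And>M t. L2_set (\<lambda>n. cmod (x n t)) {N..<M} \<le> e"
proof -
  from assms have "\<exists>N. \<forall>M t. L2_set (\<lambda>n. cmod (x n t)) {N..<M} \<le> e"
    by (simp add: ell2_def)
  then show ?thesis using that by blast
qed

text \<open>A tail is bounded by 1 uniformly, and each of the finitely many remaining coordinates by
  its supremum norm.\<close>

lemma ell2_imp_ell2_bounded:
  assumes x: "x \<in> ell2"
  obtains c where "0 \<le> c" "ell2_bounded c x"
proof -
  obtain N where N: "\<And>M t. L2_set (\<lambda>n. cmod (x n t)) {N..<M} \<le> 1"
    using ell2_tail[OF x, of 1] by auto
  define s where "s = (\<Sum>n<N. (sup_norm (x n))\<^sup>2)"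
  have "L2_set (\<lambda>n. cmod (x n t)) {..<M} \<le> sqrt (s + 1)" for M t
  proof -
    have "(\<Sum>n<M. (cmod (x n t))\<^sup>2) \<le> (\<Sum>n\<in>{..<N} \<union> {N..<M}. (cmod (x n t))\<^sup>2)"
      by (intro sum_mono2) auto
    also have "\<dots> = (\<Sum>n<N. (cmod (x n t))\<^sup>2) + (\<Sum>n\<in>{N..<M}. (cmod (x n t))\<^sup>2)"
      by (intro sum.union_disjoint) auto
    also have "\<dots> \<le> s + 1"
    proof (rule add_mono)
      show "(\<Sum>n<N. (cmod (x n t))\<^sup>2) \<le> s"
        unfolding s_def
        by (intro sum_mono power_mono cmod_le_sup_norm) (use x in \<open>auto simp: ell2_bcontfun\<close>)
      show "(\<Sum>n\<in>{N..<M}. (cmod (x n t))\<^sup>2) \<le> 1"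
        using N[of t M] by (simp add: L2_set_def)
    qed
    finally show ?thesis by (simp add: L2_set_def)
  qed
  moreover have "0 \<le> s" by (simp add: s_def sum_nonneg)
  ultimately show ?thesis
    using that[of "sqrt (s + 1)"] x by (auto simp: ell2_bounded_def ell2_bcontfun)
qed

lemma sum_cmod_mult_le_L2_set:
  "(\<Sum>n\<in>A. cmod (a n * x n)) \<le> L2_set (\<lambda>n. cmod (a n)) A * L2_set (\<lambda>n. cmod (x n)) A"
  using L2_set_mult_ineq[of "\<lambda>n. cmod (a n)" "\<lambda>n. cmod (x n)" A] by (simp add: norm_mult)

text \<open>Cauchy-Schwarz at a single point t: the bound d on x is required only there, while c is
  uniform.\<close>

lemma
  assumes a: "ell2_bounded c a"
    and x: "\<And>M. L2_set (\<lambda>n. cmod (x n t)) {..<M} \<le> d"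
  shows summable_norm_pairing: "summable (\<lambda>n. cmod (a n t * x n t))"
    and cmod_pairing_le: "cmod (pairing a x t) \<le> c * d"
proof -
  have cd: "0 \<le> c" "0 \<le> d"
    using ell2_bounded_nonneg[OF a] x[of 0] by auto
  have le: "(\<Sum>n<M. cmod (a n t * x n t)) \<le> c * d" for M
  proof (rule order_trans[OF sum_cmod_mult_le_L2_set mult_mono])
    show "L2_set (\<lambda>n. cmod (a n t)) {..<M} \<le> c"
      using a by (simp add: ell2_bounded_def)
  qed (use x cd in auto)
  show summ: "summable (\<lambda>n. cmod (a n t * x n t))"
    by (rule summableI_nonneg_bounded[OF _ le]) simp
  have "cmod (pairing a x t) \<le> suminf (\<lambda>n. cmod (a n t * x n t))"
    unfolding pairing_def by (rule summable_norm[OF summ])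
  also have "\<dots> \<le> c * d" by (rule suminf_le_const[OF summ le])
  finally show "cmod (pairing a x t) \<le> c * d" .
qed

lemma summable_pairing:
  assumes "ell2_bounded c a" "x \<in> ell2"
  shows "summable (\<lambda>n. a n t * x n t)"
proof -
  obtain d where "ell2_bounded d x" using ell2_imp_ell2_bounded[OF assms(2)] by blast
  then have "summable (\<lambda>n. cmod (a n t * x n t))"
    by (intro summable_norm_pairing[OF assms(1), where d=d]) (simp add: ell2_bounded_def)
  then show ?thesis by (rule summable_norm_cancel)
qed

text \<open>On a block of indices Cauchy-Schwarz bounds the sum by c times the block norm of x,
  which is uniformly small far out. So the partial sums are uniformly Cauchy although the tails of a
  need not be small.\<close>

lemma pairing_bcontfun:
  assumes a: "ell2_bounded c a" and x: "x \<in> ell2"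
  shows "pairing a x \<in> bcontfun"
proof -
  define g where "g m t = (\<Sum>n<m. a n t * x n t)" for m t
  have c: "0 \<le> c" using a by (rule ell2_bounded_nonneg)
  have g: "g m \<in> bcontfun" for m
    unfolding g_def using a x
    by (intro bcontfun_sum bcontfun_mult) (auto simp: ell2_bounded_def ell2_bcontfun)
  have close: "dist (g i t) (g j t) \<le> c * e" if "i \<le> j" and
    e: "\<And>M t. L2_set (\<lambda>n. cmod (x n t)) {i..<M} \<le> e" for i j t e
  proof -
    have "g j t - g i t = (\<Sum>n\<in>{i..<j}. a n t * x n t)"
      unfolding g_def using sum_diff_nat_ivl[of 0 i j "\<lambda>n. a n t * x n t"] \<open>i \<le> j\<close>
      by (simp add: atLeast0LessThan)
    then have "dist (g i t) (g j t) = cmod (\<Sum>n\<in>{i..<j}. a n t * x n t)"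
      by (metis dist_commute dist_norm)
    also have "\<dots> \<le> (\<Sum>n\<in>{i..<j}. cmod (a n t * x n t))" by (rule norm_sum)
    also have "\<dots> \<le> L2_set (\<lambda>n. cmod (a n t)) {i..<j} * L2_set (\<lambda>n. cmod (x n t)) {i..<j}"
      by (rule sum_cmod_mult_le_L2_set)
    also have "\<dots> \<le> c * e"
    proof (rule mult_mono[OF _ e c L2_set_nonneg])
      have "L2_set (\<lambda>n. cmod (a n t)) {i..<j} \<le> L2_set (\<lambda>n. cmod (a n t)) {..<j}"
        by (intro L2_set_mono_set) auto
      also have "\<dots> \<le> c" using a by (simp add: ell2_bounded_def)
      finally show "L2_set (\<lambda>n. cmod (a n t)) {i..<j} \<le> c" .
    qed
    finally show ?thesis .
  qed
  have "\<exists>h\<in>bcontfun. \<forall>e>0. \<exists>N. \<forall>i\<ge>N. \<forall>t. dist (g i t) (h t) \<le> e"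
  proof (rule bcontfun_sup_Cauchy_convergent[OF g])
    fix e :: real assume "e > 0"
    \<comment> \<open>Dividing by c + 1 instead of c covers the case c = 0.\<close>
    with c have "e / (c + 1) > 0" by simp
    then obtain N where N: "\<And>M t. L2_set (\<lambda>n. cmod (x n t)) {N..<M} \<le> e / (c + 1)"
      using ell2_tail[OF x] by blast
    have *: "dist (g i t) (g j t) \<le> e" if "N \<le> i" "i \<le> j" for i j t
    proof -
      have "L2_set (\<lambda>n. cmod (x n t)) {i..<M} \<le> e / (c + 1)" for M t
        using that by (intro order_trans[OF L2_set_mono_set N[where M=M and t=t]]) auto
      then have "dist (g i t) (g j t) \<le> c * (e / (c + 1))" by (rule close[OF \<open>i \<le> j\<close>])
      also have "\<dots> \<le> e" using c \<open>e > 0\<close> by (simp add: field_simps)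
      finally show ?thesis .
    qed
    have "dist (g i t) (g j t) \<le> e" if "N \<le> i" "N \<le> j" for i j t
      using *[of i j t] *[of j i t] that by (cases "i \<le> j") (simp_all add: dist_commute)
    then show "\<exists>N. \<forall>i\<ge>N. \<forall>j\<ge>N. \<forall>t. dist (g i t) (g j t) \<le> e" by blast
  qed
  then obtain h where h: "h \<in> bcontfun"
    "\<And>e. e > 0 \<Longrightarrow> \<exists>N. \<forall>i\<ge>N. \<forall>t. dist (g i t) (h t) \<le> e"
    by blast
  \<comment> \<open>The uniform limit and the series are both pointwise limits of the same partial
    sums.\<close>
  have "pairing a x t = h t" for t
  proof (rule LIMSEQ_unique)
    show "(\<lambda>m. g m t) \<longlonglongrightarrow> pairing a x t"
      unfolding g_def pairing_def by (rule summable_LIMSEQ[OF summable_pairing[OF a x]])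
    show "(\<lambda>m. g m t) \<longlonglongrightarrow> h t"
    proof (rule metric_LIMSEQ_I)
      fix r :: real assume "r > 0"
      then have "r/2 > 0" by simp
      from h(2)[OF this] obtain N where N: "\<forall>i\<ge>N. \<forall>t. dist (g i t) (h t) \<le> r/2" by blast
      have "dist (g i t) (h t) < r" if "i \<ge> N" for i
      proof -
        have "dist (g i t) (h t) \<le> r/2" using N that by blast
        also have "\<dots> < r" using \<open>r > 0\<close> by simp
        finally show ?thesis .
      qed
      then show "\<exists>N. \<forall>i\<ge>N. dist (g i t) (h t) < r" by blast
    qed
  qed
  then have "pairing a x = h" by (rule ext)
  with h(1) show ?thesis by simp
qed

section \<open>The inner product and completeness\<close>

lemma ell2_add:
  assumes x: "x \<in> ell2" and y: "y \<in> ell2"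
  shows "(\<lambda>n t. x n t + y n t) \<in> ell2"
  unfolding ell2_def
proof (intro CollectI conjI allI impI)
  show "(\<lambda>t. x n t + y n t) \<in> bcontfun" for n
    using x y by (simp add: bcontfun_add ell2_bcontfun)
  fix e :: real assume "e > 0"
  then have "e/2 > 0" by simp
  obtain N1 where N1: "\<And>M t. L2_set (\<lambda>n. cmod (x n t)) {N1..<M} \<le> e/2"
    using ell2_tail[OF x \<open>e/2 > 0\<close>] by blast
  obtain N2 where N2: "\<And>M t. L2_set (\<lambda>n. cmod (y n t)) {N2..<M} \<le> e/2"
    using ell2_tail[OF y \<open>e/2 > 0\<close>] by blast
  have "L2_set (\<lambda>n. cmod (x n t + y n t)) {max N1 N2..<M} \<le> e" for M t
  proof -
    have "L2_set (\<lambda>n. cmod (x n t + y n t)) {max N1 N2..<M} \<le>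
        L2_set (\<lambda>n. cmod (x n t)) {max N1 N2..<M} + L2_set (\<lambda>n. cmod (y n t)) {max N1 N2..<M}"
      by (rule L2_set_norm_add_le)
    also have "\<dots> \<le> L2_set (\<lambda>n. cmod (x n t)) {N1..<M} + L2_set (\<lambda>n. cmod (y n t)) {N2..<M}"
      by (intro add_mono L2_set_mono_set) auto
    also have "\<dots> \<le> e/2 + e/2" by (intro add_mono N1 N2)
    finally show ?thesis by simp
  qed
  then show "\<exists>N. \<forall>M t. L2_set (\<lambda>n. cmod (x n t + y n t)) {N..<M} \<le> e" by blast
qed

lemma ell2_mult:
  assumes x: "x \<in> ell2" and b: "b \<in> bcontfun"
  shows "(\<lambda>n t. x n t * b t) \<in> ell2"
  unfolding ell2_def
proof (intro CollectI conjI allI impI)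
  show "(\<lambda>t. x n t * b t) \<in> bcontfun" for n
    using x b by (simp add: bcontfun_mult ell2_bcontfun)
  obtain c where c: "0 \<le> c" "\<And>t. cmod (b t) \<le> c" using bcontfun_bounded[OF b] by blast
  fix e :: real assume "e > 0"
  then have "e/(c+1) > 0" using c by simp
  then obtain N where N: "\<And>M t. L2_set (\<lambda>n. cmod (x n t)) {N..<M} \<le> e/(c+1)"
    using ell2_tail[OF x] by blast
  have "L2_set (\<lambda>n. cmod (x n t * b t)) {N..<M} \<le> e" for M t
  proof -
    have "L2_set (\<lambda>n. cmod (x n t * b t)) {N..<M} = cmod (b t) * L2_set (\<lambda>n. cmod (x n t)) {N..<M}"
      by (simp add: L2_set_right_distrib norm_mult mult.commute)
    also have "\<dots> \<le> c * (e/(c+1))" by (intro mult_mono c N) auto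
    also have "\<dots> \<le> e" using c \<open>e > 0\<close> by (simp add: field_simps)
    finally show ?thesis .
  qed
  then show "\<exists>N. \<forall>M t. L2_set (\<lambda>n. cmod (x n t * b t)) {N..<M} \<le> e" by blast
qed

lemma ell2_cmult: "x \<in> ell2 \<Longrightarrow> (\<lambda>n t. z * x n t) \<in> ell2"
  using ell2_mult[OF _ const_bcontfun[of z]] by (simp add: mult.commute)

lemma ell2_uminus: "x \<in> ell2 \<Longrightarrow> (\<lambda>n t. - x n t) \<in> ell2"
  using ell2_cmult[of x "-1"] by simp

lemma ell2_diff: "x \<in> ell2 \<Longrightarrow> y \<in> ell2 \<Longrightarrow> (\<lambda>n t. x n t - y n t) \<in> ell2"
  using ell2_add[OF _ ell2_uminus] by fastforce

lemma ell2_finite_support: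
  assumes "\<And>n. x n \<in> bcontfun" "\<And>n t. n \<ge> N \<Longrightarrow> x n t = 0"
  shows "x \<in> ell2"
proof -
  have "L2_set (\<lambda>n. cmod (x n t)) {N..<M} = 0" for M t
    by (rule L2_set_0') (use assms(2) in auto)
  then show ?thesis
    unfolding ell2_def using assms(1) by (auto intro!: exI[of _ N])
qed

lemma ell2_zero: "(\<lambda>n t. 0) \<in> ell2"
  by (rule ell2_finite_support) (auto intro: const_bcontfun)

lemma ell2_bounded_cnj: "ell2_bounded c x \<Longrightarrow> ell2_bounded c (\<lambda>n t. cnj (x n t))"
  by (simp add: ell2_bounded_def bcontfun_cnj)

lemma ell2_bounded_cnjE:
  assumes "x \<in> ell2"
  obtains c where "ell2_bounded c (\<lambda>n t. cnj (x n t))"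
proof -
  obtain c where "ell2_bounded c x" using ell2_imp_ell2_bounded[OF assms] .
  from that[OF ell2_bounded_cnj[OF this]] show ?thesis .
qed

lemma summable_pairing_cnj:
  assumes "x \<in> ell2" "y \<in> ell2"
  shows "summable (\<lambda>n. cnj (x n t) * y n t)"
proof -
  obtain c where "ell2_bounded c (\<lambda>n t. cnj (x n t))" using ell2_bounded_cnjE[OF assms(1)] .
  from summable_pairing[OF this assms(2)] show ?thesis .
qed

definition ell2_inner ::
  "(nat \<Rightarrow> 'a::metric_space \<Rightarrow> complex) \<Rightarrow> (nat \<Rightarrow> 'a \<Rightarrow> complex) \<Rightarrow> 'a \<Rightarrow> complex"
  where "ell2_inner x = pairing (\<lambda>n t. cnj (x n t))"

lemma ell2_inner_bcontfun:
  assumes "x \<in> ell2" "y \<in> ell2"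
  shows "ell2_inner x y \<in> bcontfun"
proof -
  obtain c where "ell2_bounded c (\<lambda>n t. cnj (x n t))" using ell2_bounded_cnjE[OF assms(1)] .
  from pairing_bcontfun[OF this assms(2)] show ?thesis by (simp add: ell2_inner_def)
qed

lemma pairing_add_right:
  assumes "ell2_bounded c a" "x \<in> ell2" "y \<in> ell2"
  shows "pairing a (\<lambda>n t. x n t + y n t) = (\<lambda>t. pairing a x t + pairing a y t)"
  using summable_pairing[OF assms(1)] assms(2,3)
  by (auto simp: pairing_def distrib_left suminf_add)

lemma pairing_mult_right:
  assumes "ell2_bounded c a" "x \<in> ell2"
  shows "pairing a (\<lambda>n t. x n t * b t) = (\<lambda>t. pairing a x t * b t)"
  using summable_pairing[OF assms(1)] assms(2)
  by (auto simp: pairing_def suminf_mult2 mult.assoc[symmetric])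

lemma pairing_cmult_right:
  assumes "ell2_bounded c a" "x \<in> ell2"
  shows "pairing a (\<lambda>n t. z * x n t) = (\<lambda>t. z * pairing a x t)"
  using pairing_mult_right[OF assms, of "\<lambda>_. z"] by (simp add: mult.commute)

lemma pairing_zero [simp]: "pairing a (\<lambda>n t. 0) = (\<lambda>t. 0)" "pairing (\<lambda>n t. 0) a = (\<lambda>t. 0)"
  by (auto simp: pairing_def)

lemma pairing_uminus_right:
  assumes "ell2_bounded c a" "x \<in> ell2"
  shows "pairing a (\<lambda>n t. - x n t) = (\<lambda>t. - pairing a x t)"
  using pairing_cmult_right[OF assms, of "-1"] by simp

lemma pairing_finite_support:
  assumes "finite A" "\<And>n. n \<notin> A \<Longrightarrow> a n t * x n t = 0"
  shows "pairing a x t = (\<Sum>n\<in>A. a n t * x n t)"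
  unfolding pairing_def using assms by (rule suminf_finite)

lemma ell2_inner_cnj:
  assumes "x \<in> ell2" "y \<in> ell2"
  shows "cnj (ell2_inner x y t) = ell2_inner y x t"
proof -
  have "(\<lambda>n. cnj (x n t) * y n t) sums ell2_inner x y t"
    unfolding ell2_inner_def pairing_def by (rule summable_sums[OF summable_pairing_cnj[OF assms]])
  then have "(\<lambda>n. cnj (cnj (x n t) * y n t)) sums cnj (ell2_inner x y t)"
    by (simp only: sums_cnj)
  then show ?thesis
    by (simp add: sums_iff ell2_inner_def pairing_def mult.commute)
qed

lemma
  assumes x: "x \<in> ell2"
  shows summable_ell2: "summable (\<lambda>n. (cmod (x n t))\<^sup>2)"
    and ell2_inner_self: "ell2_inner x x t = of_real (suminf (\<lambda>n. (cmod (x n t))\<^sup>2))"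
proof -
  have eq: "cnj (x n t) * x n t = of_real ((cmod (x n t))\<^sup>2)" for n
    unfolding complex_norm_square by (rule mult.commute)
  have "summable (\<lambda>n. complex_of_real ((cmod (x n t))\<^sup>2))"
    using summable_pairing_cnj[OF x x, of t] by (simp only: eq)
  then show *: "summable (\<lambda>n. (cmod (x n t))\<^sup>2)"
    by (simp only: summable_complex_of_real)
  show "ell2_inner x x t = of_real (suminf (\<lambda>n. (cmod (x n t))\<^sup>2))"
    unfolding ell2_inner_def pairing_def eq using * by (simp add: suminf_of_real)
qed

lemma sqrt_le_iff_le_power2: "0 \<le> c \<Longrightarrow> sqrt a \<le> c \<longleftrightarrow> a \<le> c\<^sup>2"
  using real_le_lsqrt sqrt_le_D by blast

definition ell2_norm :: "(nat \<Rightarrow> 'a::metric_space \<Rightarrow> complex) \<Rightarrow> real"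
  where "ell2_norm x = sqrt (sup_norm (ell2_inner x x))"

text \<open>Reduces estimates of the module norm to finite sums at single points, where Minkowski's
  inequality and passage to limits are elementary.\<close>

lemma ell2_norm_le_iff:
  assumes x: "x \<in> ell2" and c: "0 \<le> c"
  shows "ell2_norm x \<le> c \<longleftrightarrow> (\<forall>M t. L2_set (\<lambda>n. cmod (x n t)) {..<M} \<le> c)"
proof -
  have "suminf (\<lambda>n. (cmod (x n t))\<^sup>2) \<le> c\<^sup>2 \<longleftrightarrow> (\<forall>M. (\<Sum>n<M. (cmod (x n t))\<^sup>2) \<le> c\<^sup>2)" for t
  proof (intro iffI allI)
    fix M assume "suminf (\<lambda>n. (cmod (x n t))\<^sup>2) \<le> c\<^sup>2"
    moreover have "(\<Sum>n<M. (cmod (x n t))\<^sup>2) \<le> suminf (\<lambda>n. (cmod (x n t))\<^sup>2)"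
      by (rule sum_le_suminf[OF summable_ell2[OF x]]) auto
    ultimately show "(\<Sum>n<M. (cmod (x n t))\<^sup>2) \<le> c\<^sup>2" by simp
  qed (auto intro: suminf_le_const[OF summable_ell2[OF x]])
  moreover have "cmod (ell2_inner x x t) = suminf (\<lambda>n. (cmod (x n t))\<^sup>2)" for t
    using suminf_nonneg[OF summable_ell2[OF x]] by (simp add: ell2_inner_self[OF x])
  ultimately show ?thesis
    using c unfolding ell2_norm_def L2_set_def
    by (simp add: sqrt_le_iff_le_power2 sup_norm_le_iff ell2_inner_bcontfun x) blast
qed

lemma ell2_norm_nonneg: "x \<in> ell2 \<Longrightarrow> 0 \<le> ell2_norm x"
  by (simp add: ell2_norm_def sup_norm_nonneg ell2_inner_bcontfun)

lemma L2_set_le_ell2_norm: "x \<in> ell2 \<Longrightarrow> L2_set (\<lambda>n. cmod (x n t)) {..<M} \<le> ell2_norm x"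
  using ell2_norm_le_iff ell2_norm_nonneg by blast

lemma cmod_le_ell2_norm:
  assumes "x \<in> ell2" shows "cmod (x n t) \<le> ell2_norm x"
proof -
  have "cmod (x n t) \<le> L2_set (\<lambda>n. cmod (x n t)) {..<Suc n}"
    by (rule member_le_L2_set) auto
  also have "\<dots> \<le> ell2_norm x" by (rule L2_set_le_ell2_norm[OF assms])
  finally show ?thesis .
qed

lemma ell2_norm_triangle:
  assumes "x \<in> ell2" "y \<in> ell2"
  shows "ell2_norm (\<lambda>n t. x n t + y n t) \<le> ell2_norm x + ell2_norm y"
proof (subst ell2_norm_le_iff)
  show "\<forall>M t. L2_set (\<lambda>n. cmod (x n t + y n t)) {..<M} \<le> ell2_norm x + ell2_norm y"
    using assms by (intro allI order_trans[OF L2_set_norm_add_le] add_mono L2_set_le_ell2_norm)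
qed (use assms in \<open>auto intro: ell2_add ell2_norm_nonneg add_nonneg_nonneg\<close>)

lemma ell2_norm_uminus: "ell2_norm (\<lambda>n t. - x n t) = ell2_norm x"
  by (simp add: ell2_norm_def ell2_inner_def pairing_def[abs_def])

lemma ell2_norm_eq_0:
  assumes "x \<in> ell2" shows "ell2_norm x = 0 \<longleftrightarrow> x = (\<lambda>n t. 0)"
proof
  assume "ell2_norm x = 0"
  then have "cmod (x n t) \<le> 0" for n t using cmod_le_ell2_norm[OF assms] by metis
  then show "x = (\<lambda>n t. 0)" by (simp add: fun_eq_iff)
next
  assume "x = (\<lambda>n t. 0)"
  then show "ell2_norm x = 0" by (simp add: ell2_norm_def ell2_inner_def sup_norm_def)
qed

text \<open>Each coordinate converges uniformly, and the coordinate limits form x. The tails of x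
  are uniformly small because they are at most a tail of one \<open>u i\<close> plus the distance
  from \<open>u i\<close> to x.\<close>

lemma ell2_complete:
  fixes u :: "nat \<Rightarrow> nat \<Rightarrow> 'a::metric_space \<Rightarrow> complex"
  assumes u: "\<And>k. u k \<in> ell2"
    and cau: "\<And>e. e > 0 \<Longrightarrow> \<exists>N. \<forall>i\<ge>N. \<forall>j\<ge>N. ell2_norm (\<lambda>n t. u i n t - u j n t) \<le> e"
  shows "\<exists>x\<in>ell2. \<forall>e>0. \<exists>N. \<forall>i\<ge>N. ell2_norm (\<lambda>n t. u i n t - x n t) \<le> e"
proof -
  have D: "(\<lambda>n t. u i n t - u j n t) \<in> ell2" for i j by (intro ell2_diff u)
  have "\<exists>h\<in>bcontfun. \<forall>e>0. \<exists>N. \<forall>i\<ge>N. \<forall>t. dist (u i n t) (h t) \<le> e" for n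
  proof (rule bcontfun_sup_Cauchy_convergent)
    show "u k n \<in> bcontfun" for k by (rule ell2_bcontfun[OF u])
    fix e :: real assume "e > 0"
    from cau[OF this] obtain N
      where N: "\<And>i j. i \<ge> N \<Longrightarrow> j \<ge> N \<Longrightarrow> ell2_norm (\<lambda>n t. u i n t - u j n t) \<le> e"
      by blast
    have "dist (u i n t) (u j n t) \<le> e" if "i \<ge> N" "j \<ge> N" for i j t
      using cmod_le_ell2_norm[OF D[of i j], of n t] N[OF that] by (simp add: dist_norm)
    then show "\<exists>N. \<forall>i\<ge>N. \<forall>j\<ge>N. \<forall>t. dist (u i n t) (u j n t) \<le> e" by blast
  qed
  then obtain x where x: "\<And>n. x n \<in> bcontfun"
    and lim: "\<And>n e. e > 0 \<Longrightarrow> \<exists>N. \<forall>i\<ge>N. \<forall>t. dist (u i n t) (x n t) \<le> e"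
    by metis
  have ptlim: "(\<lambda>i. u i n t) \<longlonglongrightarrow> x n t" for n t
  proof (rule metric_LIMSEQ_I)
    fix r :: real assume "r > 0"
    then have "r/2 > 0" by simp
    from lim[OF this] obtain N where N: "\<forall>i\<ge>N. \<forall>t. dist (u i n t) (x n t) \<le> r/2" by blast
    have "dist (u i n t) (x n t) < r" if "i \<ge> N" for i
    proof -
      have "dist (u i n t) (x n t) \<le> r/2" using N that by blast
      also have "\<dots> < r" using \<open>r > 0\<close> by simp
      finally show ?thesis .
    qed
    then show "\<exists>N. \<forall>i\<ge>N. dist (u i n t) (x n t) < r" by blast
  qed
  \<comment> \<open>The Cauchy bound is used on finitely many coordinates at one point, where j may
    tend to infinity; the index N stays independent of both.\<close>
  have close: "\<exists>N. \<forall>i\<ge>N. \<forall>M t. L2_set (\<lambda>n. cmod (u i n t - x n t)) {..<M} \<le> e" if "e > 0" for e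
  proof -
    from cau[OF that] obtain N
      where N: "\<And>i j. i \<ge> N \<Longrightarrow> j \<ge> N \<Longrightarrow> ell2_norm (\<lambda>n t. u i n t - u j n t) \<le> e"
      by blast
    have "L2_set (\<lambda>n. cmod (u i n t - x n t)) {..<M} \<le> e" if "i \<ge> N" for i M t
    proof (rule LIMSEQ_le_const2)
      show "(\<lambda>j. L2_set (\<lambda>n. cmod (u i n t - u j n t)) {..<M}) \<longlonglongrightarrow>
          L2_set (\<lambda>n. cmod (u i n t - x n t)) {..<M}"
        unfolding L2_set_def by (intro tendsto_intros ptlim)
      have "L2_set (\<lambda>n. cmod (u i n t - u j n t)) {..<M} \<le> e" if "j \<ge> N" for j
        using L2_set_le_ell2_norm[OF D[of i j]] N[OF \<open>i \<ge> N\<close> that] by (rule order_trans)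
      then show "\<exists>N. \<forall>j\<ge>N. L2_set (\<lambda>n. cmod (u i n t - u j n t)) {..<M} \<le> e" by blast
    qed
    then show ?thesis by blast
  qed
  have xe: "x \<in> ell2"
    unfolding ell2_def
  proof (intro CollectI conjI allI impI x)
    fix e :: real assume "e > 0"
    then have e2: "e/2 > 0" by simp
    from close[OF this] obtain i
      where i: "\<And>M t. L2_set (\<lambda>n. cmod (u i n t - x n t)) {..<M} \<le> e/2" by blast
    obtain N where N: "\<And>M t. L2_set (\<lambda>n. cmod (u i n t)) {N..<M} \<le> e/2"
      using ell2_tail[OF u[of i] e2] by blast
    have "L2_set (\<lambda>n. cmod (x n t)) {N..<M} \<le> e" for M t
    proof -
      have "L2_set (\<lambda>n. cmod (x n t)) {N..<M} \<le>
          L2_set (\<lambda>n. cmod (x n t - u i n t)) {N..<M} + L2_set (\<lambda>n. cmod (u i n t)) {N..<M}"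
        by (rule L2_set_norm_diff_le)
      also have "L2_set (\<lambda>n. cmod (x n t - u i n t)) {N..<M} \<le>
          L2_set (\<lambda>n. cmod (u i n t - x n t)) {..<M}"
        unfolding norm_minus_commute[of "x _ t"] by (rule L2_set_mono_set) auto
      also have "\<dots> \<le> e/2" by (rule i)
      finally show ?thesis using N[of t M] by simp
    qed
    then show "\<exists>N. \<forall>M t. L2_set (\<lambda>n. cmod (x n t)) {N..<M} \<le> e" by blast
  qed
  show ?thesis
  proof (intro bexI[OF _ xe] allI impI)
    fix e :: real assume "e > 0"
    with close[OF this] show "\<exists>N. \<forall>i\<ge>N. ell2_norm (\<lambda>n t. u i n t - x n t) \<le> e"
      by (simp add: ell2_norm_le_iff ell2_diff u xe)
  qed
qed

text \<open>Common ground for the algebra and the module: both get their metric from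
  \<open>norm_dist\<close>, which subtracts inside the record structure.\<close>

locale normed_abelian_group = abelian_group M for M :: "('a, 'm) ring_scheme" (structure) +
  fixes nrm :: "'a \<Rightarrow> real"
  assumes nrm_nonneg: "x \<in> carrier M \<Longrightarrow> 0 \<le> nrm x"
    and nrm_eq_0: "x \<in> carrier M \<Longrightarrow> nrm x = 0 \<longleftrightarrow> x = \<zero>"
    and nrm_minus: "x \<in> carrier M \<Longrightarrow> nrm (\<ominus> x) = nrm x"
    and nrm_triangle: "x \<in> carrier M \<Longrightarrow> y \<in> carrier M \<Longrightarrow> nrm (x \<oplus> y) \<le> nrm x + nrm y"
begin

lemma nrm_diff_commute:
  assumes "x \<in> carrier M" "y \<in> carrier M"
  shows "nrm (x \<ominus> y) = nrm (y \<ominus> x)"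
proof -
  have "y \<ominus> x = \<ominus> (x \<ominus> y)"
    using assms by (simp add: a_minus_def minus_add a_comm)
  with assms show ?thesis by (simp add: nrm_minus)
qed

lemma Metric_space_norm_dist: "Metric_space (carrier M) (norm_dist M nrm)"
proof
  show "0 \<le> norm_dist M nrm x y" for x y by (simp add: norm_dist_def nrm_nonneg)
  show "norm_dist M nrm x y = norm_dist M nrm y x" for x y
    by (simp add: norm_dist_def nrm_diff_commute)
  show "norm_dist M nrm x y = 0 \<longleftrightarrow> x = y" if "x \<in> carrier M" "y \<in> carrier M" for x y
  proof -
    have "x = (x \<ominus> y) \<oplus> y" using that by (simp add: a_minus_def a_assoc l_neg)
    then have "x \<ominus> y = \<zero> \<longleftrightarrow> x = y"
      using that by (metis a_minus_def l_zero r_neg)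
    then show ?thesis using that by (simp add: norm_dist_def nrm_eq_0)
  qed
  show "norm_dist M nrm x z \<le> norm_dist M nrm x y + norm_dist M nrm y z"
    if xyz: "x \<in> carrier M" "y \<in> carrier M" "z \<in> carrier M" for x y z
  proof -
    have "x \<ominus> z = (x \<ominus> y) \<oplus> (y \<ominus> z)"
      using xyz by (simp add: a_minus_def a_assoc r_neg1 r_neg2)
    then show ?thesis using xyz nrm_triangle[of "x \<ominus> y" "y \<ominus> z"] by (simp add: norm_dist_def)
  qed
qed

text \<open>Non-strict inequalities suit norms that are suprema: a bound \<open>\<le> e\<close> is
  equivalent to pointwise bounds, a strict one is not. The strict form is recovered with
  e/2.\<close>

lemma mcomplete_norm_distI:
  assumes "\<And>u :: nat \<Rightarrow> 'a. (\<And>k. u k \<in> carrier M) \<Longrightarrow>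
      (\<And>e. e > 0 \<Longrightarrow> \<exists>N. \<forall>i\<ge>N. \<forall>j\<ge>N. nrm (u i \<ominus> u j) \<le> e) \<Longrightarrow>
      \<exists>l\<in>carrier M. \<forall>e>0. \<exists>N. \<forall>i\<ge>N. nrm (u i \<ominus> l) \<le> e"
  shows "Metric_space.mcomplete (carrier M) (norm_dist M nrm)"
proof -
  interpret Metric_space "carrier M" "norm_dist M nrm" by (rule Metric_space_norm_dist)
  show ?thesis
    unfolding mcomplete_def
  proof (intro allI impI)
    fix u assume u: "MCauchy u"
    then have Xc: "u k \<in> carrier M" for k by (auto simp: MCauchy_def)
    have "\<exists>l\<in>carrier M. \<forall>e>0. \<exists>N. \<forall>i\<ge>N. nrm (u i \<ominus> l) \<le> e"
    proof (rule assms)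
      show "u k \<in> carrier M" for k by (rule Xc)
      fix e :: real assume "e > 0"
      with u obtain N where "\<forall>i j. N \<le> i \<longrightarrow> N \<le> j \<longrightarrow> norm_dist M nrm (u i) (u j) < e"
        unfolding MCauchy_def by blast
      then show "\<exists>N. \<forall>i\<ge>N. \<forall>j\<ge>N. nrm (u i \<ominus> u j) \<le> e"
        by (auto simp: norm_dist_def Xc intro: less_imp_le)
    qed
    then obtain l where l: "l \<in> carrier M" "\<And>e. e > 0 \<Longrightarrow> \<exists>N. \<forall>i\<ge>N. nrm (u i \<ominus> l) \<le> e"
      by blast
    have "limitin mtopology u l sequentially"
      unfolding limit_metric_sequentially
    proof (intro conjI allI impI l(1))
      fix e :: real assume "e > 0"
      then have "e/2 > 0" by simp
      from l(2)[OF this] obtain N where N: "\<forall>i\<ge>N. nrm (u i \<ominus> l) \<le> e/2" by blast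
      have "u i \<in> carrier M \<and> norm_dist M nrm (u i) l < e" if "i \<ge> N" for i
      proof -
        have "nrm (u i \<ominus> l) \<le> e/2" using N that by blast
        also have "\<dots> < e" using \<open>e > 0\<close> by simp
        finally show ?thesis using Xc l(1) by (simp add: norm_dist_def)
      qed
      then show "\<exists>N. \<forall>i\<ge>N. u i \<in> carrier M \<and> norm_dist M nrm (u i) l < e" by blast
    qed
    then show "\<exists>l. limitin mtopology u l sequentially" by blast
  qed
qed

lemma closedin_norm_distI:
  assumes "F \<subseteq> carrier M"
    and "\<And>x. x \<in> carrier M - F \<Longrightarrow> \<exists>r>0. \<forall>y\<in>F. r \<le> nrm (x \<ominus> y)"
  shows "closedin (Metric_space.mtopology (carrier M) (norm_dist M nrm)) F"
proof -
  interpret Metric_space "carrier M" "norm_dist M nrm" by (rule Metric_space_norm_dist)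
  have "\<exists>r>0. disjnt F (mball x r)" if "x \<in> carrier M - F" for x
  proof -
    from assms(2)[OF that] obtain r where "r > 0" "\<forall>y\<in>F. r \<le> nrm (x \<ominus> y)" by blast
    then show ?thesis
      using assms(1) that by (intro exI[of _ r]) (force simp: disjnt_def norm_dist_def)
  qed
  with assms(1) show ?thesis by (simp add: closedin_metric)
qed

end

section \<open>The Hilbert module over the bounded continuous functions\<close>

definition Cb :: "('a::metric_space \<Rightarrow> complex) cstar_structure"
  where "Cb = \<lparr>carrier = bcontfun, monoid.mult = (\<lambda>f g t. f t * g t), monoid.one = (\<lambda>t. 1),
    ring.zero = (\<lambda>t. 0), ring.add = (\<lambda>f g t. f t + g t), module.smult = (\<lambda>z f t. z * f t),
    star = (\<lambda>f t. cnj (f t)), anorm = sup_norm\<rparr>"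

lemma Cb_simps [simp]:
  "carrier Cb = bcontfun" "monoid.mult Cb = (\<lambda>f g t. f t * g t)" "ring.zero Cb = (\<lambda>t. 0)"
  "ring.add Cb = (\<lambda>f g t. f t + g t)" "module.smult Cb = (\<lambda>z f t. z * f t)"
  "star Cb = (\<lambda>f t. cnj (f t))" "anorm Cb = sup_norm"
  by (simp_all add: Cb_def)

lemma complex_ring_simps [simp]:
  "carrier complex_ring = UNIV" "monoid.mult complex_ring = (*)" "monoid.one complex_ring = 1"
  "ring.zero complex_ring = 0" "ring.add complex_ring = (+)"
  by (simp_all add: ring_of_type_algebra_def)

lemma abelian_group_Cb: "abelian_group Cb"
proof (rule abelian_groupI)
  show "\<exists>y\<in>carrier Cb. y \<oplus>\<^bsub>Cb\<^esub> x = \<zero>\<^bsub>Cb\<^esub>" if "x \<in> carrier Cb" for x :: "'a \<Rightarrow> complex"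
    using that by (intro bexI[of _ "\<lambda>t. - x t"]) (auto intro: bcontfun_uminus)
qed (auto simp: algebra_simps intro: bcontfun_add const_bcontfun)

lemma module_Cb: "Module.module complex_ring Cb"
  by (rule moduleI)
    (auto simp: algebra_simps intro: cring_from_type_algebra abelian_group_Cb bcontfun_cmult)

lemma a_inv_Cb: "f \<in> bcontfun \<Longrightarrow> \<ominus>\<^bsub>Cb\<^esub> f = (\<lambda>t. - f t)"
  by (rule abelian_group.minus_equality[OF abelian_group_Cb]) (auto intro: bcontfun_uminus)

lemma a_minus_Cb: "g \<in> bcontfun \<Longrightarrow> f \<ominus>\<^bsub>Cb\<^esub> g = (\<lambda>t. f t - g t)"
  by (simp add: a_minus_def a_inv_Cb)

lemma sup_norm_eq_0:
  fixes f :: "'a::metric_space \<Rightarrow> complex"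
  assumes "f \<in> bcontfun" shows "sup_norm f = 0 \<longleftrightarrow> f = (\<lambda>t. 0)"
proof
  assume "sup_norm f = 0"
  then have "cmod (f t) \<le> 0" for t using cmod_le_sup_norm[OF assms] by metis
  then show "f = (\<lambda>t. 0)" by (simp add: fun_eq_iff)
qed (simp add: sup_norm_def)

lemma sup_norm_uminus: "sup_norm (\<lambda>t. - f t) = sup_norm f"
  by (simp add: sup_norm_def)

lemma sup_norm_add_le:
  fixes f :: "'a::metric_space \<Rightarrow> complex"
  assumes "f \<in> bcontfun" "g \<in> bcontfun"
  shows "sup_norm (\<lambda>t. f t + g t) \<le> sup_norm f + sup_norm g"
proof (subst sup_norm_le_iff)
  show "\<forall>t. cmod (f t + g t) \<le> sup_norm f + sup_norm g"
    using assms by (intro allI order_trans[OF norm_triangle_ineq] add_mono cmod_le_sup_norm)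
qed (intro bcontfun_add assms)

lemma sup_norm_mult_le:
  fixes f :: "'a::metric_space \<Rightarrow> complex"
  assumes "f \<in> bcontfun" "g \<in> bcontfun"
  shows "sup_norm (\<lambda>t. f t * g t) \<le> sup_norm f * sup_norm g"
proof (subst sup_norm_le_iff)
  show "\<forall>t. cmod (f t * g t) \<le> sup_norm f * sup_norm g"
    using assms unfolding norm_mult
    by (intro allI mult_mono cmod_le_sup_norm sup_norm_nonneg) auto
qed (intro bcontfun_mult assms)

lemma sup_norm_cmult:
  fixes f :: "'a::metric_space \<Rightarrow> complex"
  assumes f: "f \<in> bcontfun"
  shows "sup_norm (\<lambda>t. z * f t) = cmod z * sup_norm f"
proof (cases "z = 0")
  case True
  then show ?thesis by (simp add: sup_norm_def)
next
  case False
  show ?thesis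
  proof (rule antisym)
    show "sup_norm (\<lambda>t. z * f t) \<le> cmod z * sup_norm f"
    proof (subst sup_norm_le_iff)
      show "\<forall>t. cmod (z * f t) \<le> cmod z * sup_norm f"
        using f unfolding norm_mult by (intro allI mult_left_mono cmod_le_sup_norm) auto
    qed (intro bcontfun_cmult f)
    \<comment> \<open>The reverse bound divides by the modulus of z, hence the case split.\<close>
    have "cmod (f t) \<le> sup_norm (\<lambda>t. z * f t) / cmod z" for t
      using cmod_le_sup_norm[OF bcontfun_cmult[OF f], of z t] False
      by (simp add: norm_mult field_simps)
    then have "sup_norm f \<le> sup_norm (\<lambda>t. z * f t) / cmod z"
      by (simp add: sup_norm_le_iff f)
    then show "cmod z * sup_norm f \<le> sup_norm (\<lambda>t. z * f t)"
      using False by (simp add: field_simps)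
  qed
qed

lemma sup_norm_cnj_mult_self:
  fixes f :: "'a::metric_space \<Rightarrow> complex"
  assumes f: "f \<in> bcontfun"
  shows "sup_norm (\<lambda>t. cnj (f t) * f t) = (sup_norm f)\<^sup>2"
proof (rule antisym)
  have b: "(\<lambda>t. cnj (f t) * f t) \<in> bcontfun" by (intro bcontfun_mult bcontfun_cnj f)
  show "sup_norm (\<lambda>t. cnj (f t) * f t) \<le> (sup_norm f)\<^sup>2"
  proof (subst sup_norm_le_iff[OF b], intro allI)
    show "cmod (cnj (f t) * f t) \<le> (sup_norm f)\<^sup>2" for t
      using cmod_le_sup_norm[OF f, of t]
      by (simp add: norm_mult power2_eq_square mult_mono sup_norm_nonneg f)
  qed
  \<comment> \<open>With the square root on the right the bound concerns f itself, so it passes to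
    the supremum of f.\<close>
  have "cmod (f t) \<le> sqrt (sup_norm (\<lambda>t. cnj (f t) * f t))" for t
    using cmod_le_sup_norm[OF b, of t]
    by (intro real_le_rsqrt) (simp add: norm_mult power2_eq_square)
  then have "sup_norm f \<le> sqrt (sup_norm (\<lambda>t. cnj (f t) * f t))"
    by (simp add: sup_norm_le_iff f)
  then show "(sup_norm f)\<^sup>2 \<le> sup_norm (\<lambda>t. cnj (f t) * f t)"
    by (metis b f real_sqrt_pow2 power_mono sup_norm_nonneg)
qed

lemma normed_abelian_group_Cb: "normed_abelian_group Cb sup_norm"
proof (intro normed_abelian_group.intro normed_abelian_group_axioms.intro abelian_group_Cb)
qed (auto simp: sup_norm_nonneg sup_norm_eq_0 a_inv_Cb sup_norm_uminus sup_norm_add_le)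

lemma mcomplete_Cb:
  "Metric_space.mcomplete (carrier Cb) (norm_dist Cb (sup_norm :: ('a::metric_space \<Rightarrow> complex) \<Rightarrow> real))"
proof (rule normed_abelian_group.mcomplete_norm_distI[OF normed_abelian_group_Cb])
  fix u :: "nat \<Rightarrow> 'a \<Rightarrow> complex"
  assume "\<And>k. u k \<in> carrier Cb"
    and cau: "\<And>e. e > 0 \<Longrightarrow> \<exists>N. \<forall>i\<ge>N. \<forall>j\<ge>N. sup_norm (u i \<ominus>\<^bsub>Cb\<^esub> u j) \<le> e"
  then have u: "u k \<in> bcontfun" for k by simp
  have d: "(\<lambda>t. f t - g t) \<in> bcontfun" if "f \<in> bcontfun" "g \<in> bcontfun" for f g :: "'a \<Rightarrow> complex"
    using bcontfun_add[OF that(1) bcontfun_uminus[OF that(2)]] by simp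
  have eq: "sup_norm (f \<ominus>\<^bsub>Cb\<^esub> g) \<le> e \<longleftrightarrow> (\<forall>t. dist (f t) (g t) \<le> e)"
    if "f \<in> bcontfun" "g \<in> bcontfun" for f g :: "'a \<Rightarrow> complex" and e
    using that by (simp add: a_minus_Cb sup_norm_le_iff d dist_norm)
  have "\<exists>h\<in>bcontfun. \<forall>e>0. \<exists>N. \<forall>i\<ge>N. \<forall>t. dist (u i t) (h t) \<le> e"
    by (rule bcontfun_sup_Cauchy_convergent[OF u]) (use cau in \<open>simp add: eq u\<close>)
  then show "\<exists>l\<in>carrier Cb. \<forall>e>0. \<exists>N. \<forall>i\<ge>N. sup_norm (u i \<ominus>\<^bsub>Cb\<^esub> l) \<le> e"
    by (simp add: eq u cong: bex_cong)
qed

lemma cstar_algebra_Cb: "cstar_algebra Cb"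
  by (intro cstar_algebra.intro cstar_algebra_axioms.intro module_Cb)
    (auto simp: algebra_simps bcontfun_mult bcontfun_cnj sup_norm_nonneg sup_norm_eq_0
      sup_norm_add_le sup_norm_cmult sup_norm_mult_le mcomplete_Cb[simplified]
      sup_norm_cnj_mult_self[unfolded mult.commute[of "cnj _"]])

definition ell2_module :: "('a::metric_space \<Rightarrow> complex, nat \<Rightarrow> 'a \<Rightarrow> complex) hilbert_structure"
  where "ell2_module = \<lparr>carrier = ell2, monoid.mult = undefined, monoid.one = undefined,
    ring.zero = (\<lambda>n t. 0), ring.add = (\<lambda>x y n t. x n t + y n t), module.smult = (\<lambda>z x n t. z * x n t),
    ract = (\<lambda>x b n t. x n t * b t), ip = ell2_inner\<rparr>"

lemma ell2_module_simps [simp]: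
  "carrier ell2_module = ell2" "ring.zero ell2_module = (\<lambda>n t. 0)"
  "ring.add ell2_module = (\<lambda>x y n t. x n t + y n t)" "module.smult ell2_module = (\<lambda>z x n t. z * x n t)"
  "ract ell2_module = (\<lambda>x b n t. x n t * b t)" "ip ell2_module = ell2_inner"
  by (simp_all add: ell2_module_def)

lemma hnorm_ell2_module [simp]: "hnorm Cb ell2_module = ell2_norm"
  by (simp add: fun_eq_iff hnorm_def ell2_norm_def)

lemma abelian_group_ell2_module: "abelian_group ell2_module"
proof (rule abelian_groupI)
  show "\<exists>y\<in>carrier ell2_module. y \<oplus>\<^bsub>ell2_module\<^esub> x = \<zero>\<^bsub>ell2_module\<^esub>"
    if "x \<in> carrier ell2_module" for x :: "nat \<Rightarrow> 'a \<Rightarrow> complex"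
    using that by (intro bexI[of _ "\<lambda>n t. - x n t"]) (auto intro: ell2_uminus)
qed (auto simp: algebra_simps intro: ell2_add ell2_zero)

lemma module_ell2_module: "Module.module complex_ring ell2_module"
  by (rule moduleI)
    (auto simp: algebra_simps intro: cring_from_type_algebra abelian_group_ell2_module ell2_cmult)

lemma a_inv_ell2_module: "x \<in> ell2 \<Longrightarrow> \<ominus>\<^bsub>ell2_module\<^esub> x = (\<lambda>n t. - x n t)"
  by (rule abelian_group.minus_equality[OF abelian_group_ell2_module]) (auto intro: ell2_uminus)

lemma a_minus_ell2_module: "y \<in> ell2 \<Longrightarrow> x \<ominus>\<^bsub>ell2_module\<^esub> y = (\<lambda>n t. x n t - y n t)"
  by (simp add: a_minus_def a_inv_ell2_module)

lemma normed_abelian_group_ell2_module: "normed_abelian_group ell2_module ell2_norm"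
proof (intro normed_abelian_group.intro normed_abelian_group_axioms.intro abelian_group_ell2_module)
qed (auto simp: ell2_norm_nonneg ell2_norm_eq_0 a_inv_ell2_module ell2_norm_uminus ell2_norm_triangle)

lemma mcomplete_ell2_module: "Metric_space.mcomplete ell2 (norm_dist ell2_module ell2_norm)"
proof -
  have "Metric_space.mcomplete (carrier ell2_module)
    (norm_dist ell2_module (ell2_norm :: (nat \<Rightarrow> 'a::metric_space \<Rightarrow> complex) \<Rightarrow> real))"
  proof (rule normed_abelian_group.mcomplete_norm_distI[OF normed_abelian_group_ell2_module])
    fix u :: "nat \<Rightarrow> nat \<Rightarrow> 'a \<Rightarrow> complex"
    assume "\<And>k. u k \<in> carrier ell2_module"
      and cau: "\<And>e. e > 0 \<Longrightarrow> \<exists>N. \<forall>i\<ge>N. \<forall>j\<ge>N. ell2_norm (u i \<ominus>\<^bsub>ell2_module\<^esub> u j) \<le> e"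
    then have u: "u k \<in> ell2" for k by simp
    have "\<exists>l\<in>ell2. \<forall>e>0. \<exists>N. \<forall>i\<ge>N. ell2_norm (\<lambda>n t. u i n t - l n t) \<le> e"
      by (rule ell2_complete[OF u]) (use cau in \<open>simp add: a_minus_ell2_module u\<close>)
    then show "\<exists>l\<in>carrier ell2_module. \<forall>e>0. \<exists>N. \<forall>i\<ge>N. ell2_norm (u i \<ominus>\<^bsub>ell2_module\<^esub> l) \<le> e"
      by (simp add: a_minus_ell2_module cong: bex_cong)
  qed
  then show ?thesis by simp
qed

lemma cstar_positive_ell2_inner_self:
  assumes "x \<in> ell2" shows "cstar_positive Cb (ell2_inner x x)"
proof -
  \<comment> \<open>The positive square root, taken pointwise; \<open>Re\<close> only extracts a
    value that is already real and nonnegative.\<close>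
  define b where "b t = complex_of_real (sqrt (Re (ell2_inner x x t)))" for t
  have nn: "0 \<le> Re (ell2_inner x x t)" for t
    by (simp add: ell2_inner_self[OF assms] suminf_nonneg[OF summable_ell2[OF assms]])
  have c: "ell2_inner x x \<in> bcontfun" by (intro ell2_inner_bcontfun assms)
  then obtain d where d: "0 \<le> d" "\<And>t. cmod (ell2_inner x x t) \<le> d"
    using bcontfun_bounded by blast
  have "b \<in> bcontfun"
  proof (rule bcontfunI')
    show "continuous_on UNIV b"
      unfolding b_def using c by (auto simp: bcontfun_def intro!: continuous_intros)
    have "Re (ell2_inner x x t) \<le> d" for t using complex_Re_le_cmod d(2) by (rule order_trans)
    then show "norm (b t) \<le> sqrt d" for t unfolding b_def using nn by simp
  qed
  moreover have "ell2_inner x x t = cnj (b t) * b t" for t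
  proof -
    have "cnj (b t) * b t = of_real (Re (ell2_inner x x t))"
      unfolding b_def using nn[of t] by (simp flip: of_real_mult)
    then show ?thesis by (simp add: ell2_inner_self[OF assms])
  qed
  ultimately show ?thesis by (auto simp: cstar_positive_def fun_eq_iff)
qed

lemma ell2_inner_definite:
  assumes "x \<in> ell2" "ell2_inner x x = (\<lambda>t. 0)" shows "x = (\<lambda>n t. 0)"
proof -
  have "ell2_norm x = 0" by (simp add: ell2_norm_def assms(2) sup_norm_def)
  then show ?thesis by (simp add: ell2_norm_eq_0 assms(1))
qed

lemma
  assumes x: "x \<in> ell2" and y: "y \<in> ell2"
  shows ell2_inner_add_right: "w \<in> ell2 \<Longrightarrow>
      ell2_inner x (\<lambda>n t. y n t + w n t) = (\<lambda>t. ell2_inner x y t + ell2_inner x w t)"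
    and ell2_inner_mult_right: "ell2_inner x (\<lambda>n t. y n t * b t) = (\<lambda>t. ell2_inner x y t * b t)"
    and ell2_inner_cmult_right: "ell2_inner x (\<lambda>n t. z * y n t) = (\<lambda>t. z * ell2_inner x y t)"
proof -
  obtain c where c: "ell2_bounded c (\<lambda>n t. cnj (x n t))" using ell2_bounded_cnjE[OF x] .
  note [simp] = ell2_inner_def
  show "w \<in> ell2 \<Longrightarrow>
      ell2_inner x (\<lambda>n t. y n t + w n t) = (\<lambda>t. ell2_inner x y t + ell2_inner x w t)"
    using pairing_add_right[OF c y] by simp
  show "ell2_inner x (\<lambda>n t. y n t * b t) = (\<lambda>t. ell2_inner x y t * b t)"
    using pairing_mult_right[OF c y] by simp
  show "ell2_inner x (\<lambda>n t. z * y n t) = (\<lambda>t. z * ell2_inner x y t)"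
    using pairing_cmult_right[OF c y] by simp
qed

lemma hilbert_module_ell2_module: "hilbert_module Cb ell2_module"
  by (intro hilbert_module.intro hilbert_module_axioms.intro cstar_algebra_Cb module_ell2_module)
    (auto simp: distrib_left distrib_right mult.assoc mult.left_commute hdist_def ell2_mult ell2_inner_bcontfun ell2_inner_add_right
      ell2_inner_mult_right ell2_inner_cmult_right ell2_inner_cnj cstar_positive_ell2_inner_self
      ell2_inner_definite mcomplete_ell2_module)

section \<open>Functionals with bounded coefficients and their kernels\<close>

lemma bounded_module_map_pairing:
  assumes "ell2_bounded c a"
  shows "bounded_module_map Cb ell2_module (pairing a)"
proof -
  have "sup_norm (pairing a x) \<le> c * ell2_norm x" if "x \<in> ell2" for x
    using cmod_pairing_le[OF assms L2_set_le_ell2_norm[OF that]]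
    by (simp add: sup_norm_le_iff pairing_bcontfun[OF assms that])
  then show ?thesis
    using assms
    by (auto simp: bounded_module_map_def pairing_bcontfun pairing_add_right pairing_cmult_right
        pairing_mult_right)
qed

lemma a_kernel_pairing:
  "a_kernel ell2_module Cb (pairing a) = {x \<in> ell2. pairing a x = (\<lambda>t. 0)}"
  by (simp add: a_kernel_def')

lemma closed_submodule_kernel_pairing:
  assumes a: "ell2_bounded c a"
  shows "closed_submodule Cb ell2_module (a_kernel ell2_module Cb (pairing a))" (is "closed_submodule _ _ ?F")
proof -
  have "submodule ?F complex_ring ell2_module"
    unfolding a_kernel_pairing
    by (rule module.submoduleI[OF module_ell2_module])
      (auto simp: a_inv_ell2_module ell2_zero ell2_uminus ell2_add ell2_cmult
        pairing_uminus_right[OF a] pairing_add_right[OF a] pairing_cmult_right[OF a])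
  moreover have "ract ell2_module x b \<in> ?F" if "x \<in> ?F" "b \<in> carrier Cb" for x b
    using that by (auto simp: a_kernel_pairing ell2_mult pairing_mult_right[OF a])
  moreover have "closedin (Metric_space.mtopology (carrier ell2_module) (hdist Cb ell2_module)) ?F"
    unfolding hdist_def hnorm_ell2_module
  proof (rule normed_abelian_group.closedin_norm_distI[OF normed_abelian_group_ell2_module])
    show "?F \<subseteq> carrier ell2_module" by (auto simp: a_kernel_pairing)
    fix x assume "x \<in> carrier ell2_module - ?F"
    then have x: "x \<in> ell2" and "pairing a x \<noteq> (\<lambda>t. 0)" by (auto simp: a_kernel_pairing)
    then obtain t where t: "pairing a x t \<noteq> 0" by auto
    have c: "0 \<le> c" using a by (rule ell2_bounded_nonneg)
    \<comment> \<open>For y in the kernel, Cauchy-Schwarz bounds the value of the functional at x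
      and t by c times the norm of x - y. So r is a lower bound for the distance to the kernel; c +
      1 keeps the denominator positive.\<close>
    define r where "r = cmod (pairing a x t) / (c + 1)"
    have "r \<le> ell2_norm (x \<ominus>\<^bsub>ell2_module\<^esub> y)" if "y \<in> ?F" for y
    proof -
      have y: "y \<in> ell2" "pairing a y = (\<lambda>t. 0)" using that by (auto simp: a_kernel_pairing)
      define d where "d = (\<lambda>n t. x n t - y n t)"
      have d: "d \<in> ell2" unfolding d_def by (intro ell2_diff x y)
      have "pairing a (\<lambda>n t. d n t + y n t) = (\<lambda>t. pairing a d t + pairing a y t)"
        by (rule pairing_add_right[OF a d y(1)])
      then have "pairing a x = pairing a d" by (simp add: d_def y(2))
      then have "cmod (pairing a x t) \<le> c * ell2_norm d"
        using cmod_pairing_le[OF a L2_set_le_ell2_norm[OF d]] by simp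
      also have "\<dots> \<le> (c + 1) * ell2_norm d"
        using ell2_norm_nonneg[OF d] by (intro mult_right_mono) auto
      finally have "r \<le> ell2_norm d" unfolding r_def using c by (simp add: field_simps)
      then show ?thesis by (simp add: a_minus_ell2_module y(1) d_def)
    qed
    moreover have "r > 0" unfolding r_def using t c by simp
    ultimately show "\<exists>r>0. \<forall>y\<in>?F. r \<le> ell2_norm (x \<ominus>\<^bsub>ell2_module\<^esub> y)" by blast
  qed
  ultimately show ?thesis by (simp add: closed_submodule_def)
qed

section \<open>A functional with discontinuous norm\<close>

text \<open>An enumeration of the rationals, possibly with repetitions; these are harmless, as a
  repeated rational only makes further summands of \<open>bump\<close> vanish there.\<close>

definition rat_seq :: "nat \<Rightarrow> real"
  where "rat_seq k = of_rat (nat_to_rat_surj k)"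

lemma range_rat_seq: "range rat_seq = \<rat>"
  by (simp add: rat_seq_def Rats_eq_range_of_rat_o_nat_to_rat_surj o_def)

(* Increases, as n grows, to the function with value 2 at every irrational number and
   value at most 2 - (1/2)^k at the k-th rational number. *)
definition bump :: "nat \<Rightarrow> real \<Rightarrow> real"
  where "bump n t = (\<Sum>k<n. (1/2)^k * min 1 (real n * \<bar>t - rat_seq k\<bar>))"

text \<open>Square roots of the increments of an increasing sequence: the squares telescope,
  starting from the empty sum \<open>bump 0 t\<close>.\<close>

definition bump_coeff :: "nat \<Rightarrow> real \<Rightarrow> complex"
  where "bump_coeff n t = of_real (sqrt (bump (Suc n) t - bump n t))"

text \<open>The index n enters twice, as the slope of the ramps and as their number; raising either
  one increases the value.\<close>

lemma bump_mono: "bump n t \<le> bump (Suc n) t"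
proof -
  have "bump n t \<le> (\<Sum>k<n. (1/2)^k * min 1 (real (Suc n) * \<bar>t - rat_seq k\<bar>))"
    unfolding bump_def
    by (intro sum_mono mult_left_mono min.mono mult_right_mono) auto
  also have "\<dots> \<le> bump (Suc n) t"
    unfolding bump_def by (intro sum_mono2) auto
  finally show ?thesis .
qed

lemma sum_half_powers: "(\<Sum>k<n. (1/2)^k) = 2 - 2 * (1/2::real)^n"
  by (induction n) simp_all

lemma bump_le_sum: "bump n t \<le> (\<Sum>k<n. (1/2)^k)"
proof -
  have "bump n t \<le> (\<Sum>k<n. (1/2)^k * 1)"
    unfolding bump_def by (intro sum_mono mult_left_mono) auto
  then show ?thesis by simp
qed

lemma bump_le_2: "bump n t \<le> 2"
  using bump_le_sum[of n t] by (simp add: sum_half_powers order_trans)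

lemma bump_rat_seq_le: "bump n (rat_seq j) \<le> 2 - (1/2)^j"
proof -
  have "bump n (rat_seq j) \<le> (\<Sum>k\<in>{..<n} - {j}. (1/2)^k * 1)"
  proof -
    have "bump n (rat_seq j) = (\<Sum>k\<in>{..<n} - {j}. (1/2)^k * min 1 (real n * \<bar>rat_seq j - rat_seq k\<bar>))"
      unfolding bump_def by (intro sum.mono_neutral_right) auto
    also have "\<dots> \<le> (\<Sum>k\<in>{..<n} - {j}. (1/2)^k * 1)"
      by (intro sum_mono mult_left_mono) auto
    finally show ?thesis .
  qed
  \<comment> \<open>Enlarging the range to contain j lets (1/2)^j be subtracted from a full
    geometric sum even when n is at most j.\<close>
  also have "\<dots> \<le> (\<Sum>k\<in>{..<max n (Suc j)} - {j}. (1/2)^k)"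
    by (simp, intro sum_mono2) auto
  also have "\<dots> = (\<Sum>k<max n (Suc j). (1/2)^k) - (1/2)^j"
    by (subst sum_diff1) auto
  also have "\<dots> \<le> 2 - (1/2)^j" by (simp add: sum_half_powers)
  finally show ?thesis .
qed

text \<open>An irrational t has positive distance to each of the first m rationals, so for large n
  their ramps all have value 1 at t and contribute a geometric sum.\<close>

lemma bump_ge_if_irrational:
  assumes "t \<notin> \<rat>"
  shows "\<exists>N. \<forall>n\<ge>N. 2 - 2 * (1/2)^m \<le> bump n t"
proof -
  have pos: "0 < \<bar>t - rat_seq k\<bar>" for k
    using assms range_rat_seq by auto
  obtain N where N: "\<And>k. k < m \<Longrightarrow> 1 \<le> real N * \<bar>t - rat_seq k\<bar>"
  proof -
    \<comment> \<open>A sum in place of a maximum: it dominates each reciprocal and makes sense for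
      m = 0 as well.\<close>
    define c where "c = (\<Sum>k<m. 1 / \<bar>t - rat_seq k\<bar>)"
    obtain N where "c \<le> real N" using real_arch_simple by blast
    moreover have "1 / \<bar>t - rat_seq k\<bar> \<le> c" if "k < m" for k
      unfolding c_def using that by (intro member_le_sum) auto
    ultimately have "1 / \<bar>t - rat_seq k\<bar> \<le> real N" if "k < m" for k
      using that by (meson order_trans)
    then have "1 \<le> real N * \<bar>t - rat_seq k\<bar>" if "k < m" for k
      using that pos by (simp only: pos_divide_le_eq)
    then show ?thesis using that by blast
  qed
  \<comment> \<open>N makes the ramps steep enough; m ensures that the first m of them occur in
    \<open>bump n\<close>.\<close>
  have "2 - 2 * (1/2)^m \<le> bump n t" if n: "n \<ge> max N m" for n
  proof -
    have "min 1 (real n * \<bar>t - rat_seq k\<bar>) = 1" if "k < m" for k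
    proof -
      have "real N * \<bar>t - rat_seq k\<bar> \<le> real n * \<bar>t - rat_seq k\<bar>"
        using n by (intro mult_right_mono) auto
      with N[OF that] show ?thesis by simp
    qed
    then have "(\<Sum>k<m. (1/2)^k) = (\<Sum>k<m. (1/2)^k * min 1 (real n * \<bar>t - rat_seq k\<bar>))"
      by simp
    also have "\<dots> \<le> bump n t"
      unfolding bump_def using n by (intro sum_mono2) auto
    finally show ?thesis by (simp add: sum_half_powers)
  qed
  then show ?thesis by blast
qed

lemma sum_cmod_bump_coeff: "(\<Sum>n<M. (cmod (bump_coeff n t))\<^sup>2) = bump M t"
proof -
  have "(\<Sum>n<M. (cmod (bump_coeff n t))\<^sup>2) = (\<Sum>n<M. bump (Suc n) t - bump n t)"
    by (intro sum.cong) (auto simp: bump_coeff_def bump_mono)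
  also have "\<dots> = bump M t" by (subst sum_lessThan_telescope) (simp add: bump_def)
  finally show ?thesis .
qed

lemma ell2_bounded_bump_coeff: "ell2_bounded (sqrt 2) bump_coeff"
proof -
  have L2: "L2_set (\<lambda>n. cmod (bump_coeff n t)) {..<M} \<le> sqrt 2" for M t
    by (simp add: L2_set_def sum_cmod_bump_coeff bump_le_2)
  have "bump_coeff n \<in> bcontfun" for n
  proof (rule bcontfunI')
    show "continuous_on UNIV (bump_coeff n)"
      unfolding bump_coeff_def bump_def by (intro continuous_intros)
    have "cmod (bump_coeff n t) \<le> L2_set (\<lambda>n. cmod (bump_coeff n t)) {..<Suc n}" for t
      by (rule member_le_L2_set) auto
    then show "cmod (bump_coeff n t) \<le> sqrt 2" for t using L2 by (rule order_trans)
  qed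
  with L2 show ?thesis by (simp add: ell2_bounded_def)
qed

text \<open>The squared norm of the functional at t. In closed form it is the sum of (1/2)^k over
  all k with \<open>rat_seq k\<close> different from t.\<close>

definition bump_lim :: "real \<Rightarrow> real"
  where "bump_lim t = suminf (\<lambda>n. (cmod (bump_coeff n t))\<^sup>2)"

lemma
  shows summable_bump_coeff: "summable (\<lambda>n. (cmod (bump_coeff n t))\<^sup>2)"
    and bump_tendsto: "(\<lambda>n. bump n t) \<longlonglongrightarrow> bump_lim t"
proof -
  show *: "summable (\<lambda>n. (cmod (bump_coeff n t))\<^sup>2)"
    by (rule summableI_nonneg_bounded[where x = 2]) (auto simp: sum_cmod_bump_coeff bump_le_2)
  show "(\<lambda>n. bump n t) \<longlonglongrightarrow> bump_lim t"
    using summable_LIMSEQ[OF *] by (simp add: sum_cmod_bump_coeff bump_lim_def)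
qed

lemma bump_lim_rational: "t \<in> \<rat> \<Longrightarrow> bump_lim t < 2"
proof -
  assume "t \<in> \<rat>"
  then obtain j where t: "t = rat_seq j" using range_rat_seq by blast
  have "bump_lim t \<le> 2 - (1/2)^j"
    by (rule LIMSEQ_le_const2[OF bump_tendsto]) (simp add: t bump_rat_seq_le)
  also have "\<dots> < 2" by simp
  finally show ?thesis .
qed

lemma bump_lim_irrational:
  assumes "t \<notin> \<rat>" shows "bump_lim t = 2"
proof (rule antisym)
  show "bump_lim t \<le> 2"
    by (rule LIMSEQ_le_const2[OF bump_tendsto]) (simp add: bump_le_2)
  have "2 - 2 * (1/2)^m \<le> bump_lim t" for m
    by (rule LIMSEQ_le_const[OF bump_tendsto]) (rule bump_ge_if_irrational[OF assms])
  moreover have "(\<lambda>m. 2 - 2 * (1/2)^m) \<longlonglongrightarrow> 2 - 2 * (0::real)"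
    by (intro tendsto_intros LIMSEQ_realpow_zero) auto
  ultimately show "2 \<le> bump_lim t" by (auto intro: LIMSEQ_le_const2)
qed

text \<open>Continuity on U would make the part of U with values below 2 open. It contains a
  rational, and a nonempty open set is uncountable, so it would also contain an irrational, where
  the value is 2.\<close>

lemma bump_lim_discontinuous:
  assumes "open U" "U \<noteq> {}"
  shows "\<not> continuous_on U bump_lim"
proof
  assume c: "continuous_on U bump_lim"
  let ?V = "{t \<in> U. bump_lim t < 2}"
  have "open ?V"
    using continuous_open_preimage[OF c assms(1) open_lessThan[of 2]]
    by (simp add: Collect_conj_eq vimage_def lessThan_def)
  moreover obtain q where "q \<in> U" "q \<in> \<rat>"
  proof -
    obtain s e where "e > 0" and e: "ball s e \<subseteq> U"
      using assms by (metis all_not_in_conv open_contains_ball)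
    then obtain q where "q \<in> \<rat>" "s < q" "q < s + e"
      using Rats_dense_in_real[of s "s + e"] by auto
    with e show ?thesis using that[of q] by (auto simp: dist_real_def subset_iff)
  qed
  then have "?V \<noteq> {}" using bump_lim_rational by blast
  ultimately obtain t where "t \<in> ?V" "t \<notin> \<rat>"
    using open_minus_countable[OF countable_rat, of ?V] by blast
  then show False by (simp add: bump_lim_irrational)
qed

lemma orth_compl_kernel_bump:
  "orth_compl Cb ell2_module (a_kernel ell2_module Cb (pairing bump_coeff)) = {\<lambda>n t. 0}"
proof (intro equalityI subsetI)
  let ?K = "a_kernel ell2_module Cb (pairing bump_coeff)"
  fix y assume "y \<in> orth_compl Cb ell2_module ?K"
  then have y: "y \<in> ell2" and orth: "\<And>x. x \<in> ?K \<Longrightarrow> ell2_inner x y = (\<lambda>t. 0)"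
    by (auto simp: orth_compl_def)
  have a: "bump_coeff n \<in> bcontfun" for n
    using ell2_bounded_bump_coeff by (simp add: ell2_bounded_def)
  have cross: "bump_coeff m t * y n t = bump_coeff n t * y m t" for m n t
  proof (cases "m = n")
    case False
    \<comment> \<open>The two products \<open>bump_coeff n t * bump_coeff m t\<close> in the pairing
      cancel, which puts x in the kernel.\<close>
    define x where "x k = (if k = n then bump_coeff m else if k = m then (\<lambda>t. - bump_coeff n t)
      else (\<lambda>t. 0))" for k
    have x: "x \<in> ell2"
      by (rule ell2_finite_support[where N = "Suc (max m n)"])
        (auto simp: x_def a bcontfun_uminus const_bcontfun)
    have "pairing bump_coeff x t = (\<Sum>k\<in>{m, n}. bump_coeff k t * x k t)" for t
      by (rule pairing_finite_support) (auto simp: x_def)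
    then have "pairing bump_coeff x = (\<lambda>t. 0)"
      using False by (simp add: x_def fun_eq_iff)
    with x have "ell2_inner x y t = 0" using orth by (simp add: a_kernel_pairing)
    moreover have "ell2_inner x y t = (\<Sum>k\<in>{m, n}. cnj (x k t) * y k t)"
      unfolding ell2_inner_def by (rule pairing_finite_support) (auto simp: x_def)
    \<comment> \<open>The coefficients are real, so the conjugation in the inner product
      disappears.\<close>
    ultimately show ?thesis
      using False by (simp add: x_def bump_coeff_def)
  qed simp
  have "y n t = 0" for n t
  proof (rule ccontr)
    assume "y n t \<noteq> 0"
    define U where "U = {t. y n t \<noteq> 0}"
    have yc: "continuous_on UNIV (y n)" using ell2_bcontfun[OF y] by (simp add: bcontfun_def)
    have "open U" unfolding U_def using yc by (intro open_Collect_neq) auto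
    moreover have "U \<noteq> {}" using \<open>y n t \<noteq> 0\<close> by (auto simp: U_def)
    moreover have "bump_lim t = (cmod (bump_coeff n t))\<^sup>2 * Re (ell2_inner y y t) / (cmod (y n t))\<^sup>2"
      if "t \<in> U" for t
    proof -
      have "(cmod (y n t))\<^sup>2 * (cmod (bump_coeff m t))\<^sup>2 =
          (cmod (bump_coeff n t))\<^sup>2 * (cmod (y m t))\<^sup>2" for m
        using cross[of m t n] by (metis mult.commute norm_mult power_mult_distrib)
      then have "(cmod (y n t))\<^sup>2 * bump_lim t =
          (cmod (bump_coeff n t))\<^sup>2 * suminf (\<lambda>m. (cmod (y m t))\<^sup>2)"
        unfolding bump_lim_def
        by (simp add: suminf_mult[symmetric] summable_bump_coeff summable_ell2[OF y])
      then show ?thesis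
        using that by (simp add: ell2_inner_self[OF y] U_def field_simps)
    qed
    then have "continuous_on U bump_lim \<longleftrightarrow>
        continuous_on U (\<lambda>t. (cmod (bump_coeff n t))\<^sup>2 * Re (ell2_inner y y t) / (cmod (y n t))\<^sup>2)"
      by (intro continuous_on_cong) auto
    \<comment> \<open>The inner product of y with itself is continuous because the tails of y are
      uniformly small, and the denominator has no zero on \<open>U\<close>.\<close>
    moreover have "continuous_on U (\<lambda>t. (cmod (bump_coeff n t))\<^sup>2 * Re (ell2_inner y y t) / (cmod (y n t))\<^sup>2)"
    proof -
      have "continuous_on U f" if "f \<in> bcontfun" for f :: "real \<Rightarrow> complex"
        using that by (auto simp: bcontfun_def intro: continuous_on_subset)
      then show ?thesis
        using a[of n] ell2_bcontfun[OF y, of n] ell2_inner_bcontfun[OF y y]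
        by (intro continuous_intros) (auto simp: U_def)
    qed
    ultimately show False using bump_lim_discontinuous by blast
  qed
  then show "y \<in> {\<lambda>n t. 0}" by (simp add: fun_eq_iff)
next
  fix y :: "nat \<Rightarrow> real \<Rightarrow> complex"
  assume "y \<in> {\<lambda>n t. 0}"
  then show "y \<in> orth_compl Cb ell2_module (a_kernel ell2_module Cb (pairing bump_coeff))"
    by (simp add: orth_compl_def ell2_zero ell2_inner_def)
qed

text \<open>At an irrational t the squared coefficients sum to 2, so some coefficient is nonzero
  there; it is the value of the functional at the corresponding unit sequence.\<close>

lemma ell2_noteq_kernel_bump: "carrier ell2_module \<noteq> a_kernel ell2_module Cb (pairing bump_coeff)"
proof -
  obtain t :: real where "t \<notin> \<rat>"
    using open_minus_countable[OF countable_rat _ open_UNIV] by auto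
  then have "suminf (\<lambda>n. (cmod (bump_coeff n t))\<^sup>2) \<noteq> 0"
    using bump_lim_irrational by (simp add: bump_lim_def)
  then obtain m where m: "bump_coeff m t \<noteq> 0" by (cases "\<forall>m. bump_coeff m t = 0") auto
  define x :: "nat \<Rightarrow> real \<Rightarrow> complex" where "x k = (\<lambda>t. if k = m then 1 else 0)" for k
  have "x \<in> ell2"
    by (rule ell2_finite_support[where N = "Suc m"]) (auto simp: x_def const_bcontfun)
  moreover have "pairing bump_coeff x t = (\<Sum>k\<in>{m}. bump_coeff k t * x k t)"
    by (rule pairing_finite_support) (auto simp: x_def)
  with m have "pairing bump_coeff x t \<noteq> 0" by (simp add: x_def)
  then have "pairing bump_coeff x \<noteq> (\<lambda>t. 0)" by auto
  ultimately show ?thesis by (auto simp: a_kernel_pairing)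
qed

lemma orth_compl_zero: "orth_compl Cb ell2_module {\<lambda>n t. 0} = carrier ell2_module"
  by (auto simp: orth_compl_def ell2_inner_def)

theorem theorem1p1:
  shows "\<exists>(B :: (real \<Rightarrow> complex) cstar_structure)
      (E :: (real \<Rightarrow> complex, nat \<Rightarrow> real \<Rightarrow> complex) hilbert_structure) \<Phi> F.
    cstar_algebra B \<and> hilbert_module B E \<and>
    bounded_module_map B E \<Phi> \<and> closed_submodule B E F \<and>
    carrier E \<noteq> a_kernel E B \<Phi> \<and> F \<subseteq> a_kernel E B \<Phi> \<and>
    orth_compl B E F = {\<zero>\<^bsub>E\<^esub>} \<and>
    orth_compl B E (orth_compl B E F) \<subseteq> orth_compl B E (orth_compl B E (a_kernel E B \<Phi>)) \<and>
    orth_compl B E (orth_compl B E F) = carrier E"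
proof (intro exI conjI)
  show "cstar_algebra Cb" by (rule cstar_algebra_Cb)
  show "hilbert_module Cb ell2_module" by (rule hilbert_module_ell2_module)
  show "bounded_module_map Cb ell2_module (pairing bump_coeff)"
    by (rule bounded_module_map_pairing[OF ell2_bounded_bump_coeff])
  show "closed_submodule Cb ell2_module (a_kernel ell2_module Cb (pairing bump_coeff))"
    by (rule closed_submodule_kernel_pairing[OF ell2_bounded_bump_coeff])
  show "carrier ell2_module \<noteq> a_kernel ell2_module Cb (pairing bump_coeff)"
    by (rule ell2_noteq_kernel_bump)
\<comment> \<open>F is the kernel itself, so both inclusions are reflexive, and its second
  complement is the complement of zero.\<close>
qed (simp_all only: orth_compl_kernel_bump orth_compl_zero ell2_module_simps order_refl)

end
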